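(* Suppose $|\psi\rangle=U|0^n\rangle$ where $U$ is a depth-$d$ circuit acting on a $k$-dimensional lattice. Let $\{S^i_j\}_{1\le i\le \ell,\,1\le j\le m_i}$ be an $(\ell,c,d)$ covering scheme for the $k$-dimensional lattice, and let $W$ be the reconstruction process for $|\psi\rangle$ for this covering scheme, which satisfies $W|\psi\rangle=|\psi\rangle$. Then the backward lightcone of all output wires in $W|\psi\rangle$ is a depth-$(2\ell-1)d$ circuit $C$ which is part of $W$ (it is contained entirely within $W$, stopping at reset gates of $W$, and does not reach the input state $|\psi\rangle$ at the bottom of $W$). The circuit $C$ can be used to prepare $|\psi\rangle$ in the following sense: it acts on $n$ qubits as well as $m=O(n)$ ancilla qubits, and $$C\,|0^n\rangle\otimes|0^m\rangle=|\psi\rangle\otimes|\mathrm{junk}\rangle$$ for some $m$-qubit state $|\mathrm{junk}\rangle$.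
   Context: Lattice and circuits. The $n$ qubits, labelled by $[n]$, are located at the vertices of a finite $k$-dimensional lattice (grid graph), with edges between nearest neighbors. A depth-$d$ circuit acting on the lattice is a product of $d$ layers, each consisting of non-overlapping 2-qubit unitary gates acting on neighboring qubits. Depth-$D$ is understood as depth at most $D$. For a set of vertices $A$, $\mathcal B(A,r)$ denotes the radius-$r$ neighborhood of $A$ on the lattice (including $A$). Covering scheme. An $(\ell,c,d)$ covering scheme is a collection of subsets $S^i_j\subseteq[n]$, $1\le i\le\ell$, $1\le j\le m_i$, such that: (1) each $\mathcal B(S^i_j,d)$ has size at most $c$; (2) for every fixed $i$, the sets $\mathcal B(S^i_j,d)$, $1\le j\le m_i$, are pairwise disjoint; (3) for each qubit $v\in[n]$ there exists some $S^i_j$ with $\mathcal B(\{v\},(2\ell-1)d)\subseteq S^i_j$. Local inversion. A unitary $V$ acting on a ball of $A\subseteq[n]$ is a local inversion of $A$ for $|\psi\rangle$ if $V|\psi\rangle=|0\rangle_A\otimes|\phi\rangle$ for some pure state $|\phi\rangle$ on the other $n-|A|$ qubits, where $|0\rangle_A$ is the all-zero state on $A$. If $|\psi\rangle=U|0^n\rangle$ with $U$ a depth-$d$ circuit on the lattice, then every $A$ has a local inversion that is a depth-$d$ circuit on the lattice supported on $\mathcal B(A,d)$ (undo the gates of $U$ in the lightcone of $A$). Reconstruction process. For each $i,j$ let $V_{i,j}$ be a local inversion of $S^i_j$ for $|\psi\rangle$ that is a depth-$d$ circuit on the lattice acting on $\mathcal B(S^i_j,d)$. The reconstruction process $W$ is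 the following circuit consisting of 2-qubit unitary gates and 1-qubit reset gates (a reset gate traces out its input qubit and initializes a fresh $|0\rangle$): for $i=1,2,\dots,\ell$ in this order, (a) apply $V_{i,j}$ for all $1\le j\le m_i$ in parallel; (b) apply a reset gate to every qubit in $S^i_j$, for all $1\le j\le m_i$; (c) apply $V_{i,j}^\dagger$ for all $1\le j\le m_i$ in parallel. $W|\psi\rangle$ denotes the result of applying this process to the input state $|\psi\rangle$; since each step (b) acts trivially on the state it receives, the output is $|\psi\rangle$. Backward lightcone. Time runs from bottom (input) to top (output) of a circuit diagram. The backward lightcone of a set of output wires of a circuit consisting of 2-qubit unitary gates and 1-qubit reset gates is the sub-diagram consisting of all green gates, acting on all-zero inputs, constructed as follows. Color the given output wires blue. Repeat until nothing changes: if there is a 2-qubit gate $G$ with a blue wire on top, color $G$ green, and for each of the two wires at the bottom of $G$, if that wire is not connected to (i.e. is not the output of) a reset gate, color it blue. Each wire of the sub-diagram that begins at a reset gate of the original circuit is given a fresh $|0\rangle$ as input. When the backward lightcone does not reach the bottom input state, it is a unitary circuit acting on all-zero inputs; its qubits whose wires end at the output wires of $W$ are the $n$ system qubits and the remaining ones are the ancilla qubits. *)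

theory Defs
  imports "HOL-Analysis.Analysis"
begin

section \<open>The lattice\<close>

text \<open>Vertices of the \<open>k\<close>-dimensional box with side lengths \<open>L ! 0, \<dots>, L ! (k - 1)\<close>,
  where \<open>k = length L\<close>.\<close>

definition grid_vertices :: "nat list \<Rightarrow> nat list set" where
  "grid_vertices L = {x. length x = length L \<and> (\<forall>i<length L. x ! i < L ! i)}"

definition grid_adjacent :: "nat list \<Rightarrow> nat list \<Rightarrow> bool" where
  "grid_adjacent x y \<longleftrightarrow> length x = length y \<and>
     (\<exists>i<length x. (x ! i = y ! i + 1 \<or> y ! i = x ! i + 1) \<and>
        (\<forall>j<length x. j \<noteq> i \<longrightarrow> x ! j = y ! j))"

text \<open>\<open>E\<close> is the nearest-neighbour relation on the labels \<open>1, \<dots>, n\<close> of the vertices of a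
  finite \<open>k\<close>-dimensional grid graph.\<close>

definition is_lattice :: "nat \<Rightarrow> nat \<Rightarrow> (nat \<times> nat) set \<Rightarrow> bool" where
  "is_lattice k n E \<longleftrightarrow>
     (\<exists>L pos. length L = k \<and> (\<forall>s\<in>set L. s \<ge> 1) \<and> bij_betw pos {1..n} (grid_vertices L) \<and>
        E = {(u, v). u \<in> {1..n} \<and> v \<in> {1..n} \<and> grid_adjacent (pos u) (pos v)})"

definition nbhd :: "('q \<times> 'q) set \<Rightarrow> 'q set \<Rightarrow> nat \<Rightarrow> 'q set" where
  "nbhd E A r = {v. \<exists>u\<in>A. \<exists>s\<le>r. (u, v) \<in> E ^^ s}"

definition covering_scheme ::
  "nat \<Rightarrow> (nat \<times> nat) set \<Rightarrow> nat \<Rightarrow> nat \<Rightarrow> nat \<Rightarrow> (nat \<Rightarrow> nat) \<Rightarrow> (nat \<Rightarrow> nat \<Rightarrow> nat set) \<Rightarrow> bool" where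
  "covering_scheme n E l c d m S \<longleftrightarrow>
     (\<forall>i\<in>{1..l}. \<forall>j\<in>{1..m i}. S i j \<subseteq> {1..n}) \<and>
     (\<forall>i\<in>{1..l}. \<forall>j\<in>{1..m i}. card (nbhd E (S i j) d) \<le> c) \<and>
     (\<forall>i\<in>{1..l}. \<forall>j\<in>{1..m i}. \<forall>j'\<in>{1..m i}. j \<noteq> j' \<longrightarrow>
        nbhd E (S i j) d \<inter> nbhd E (S i j') d = {}) \<and>
     (\<forall>v\<in>{1..n}. \<exists>i\<in>{1..l}. \<exists>j\<in>{1..m i}. nbhd E {v} ((2 * l - 1) * d) \<subseteq> S i j)"


section \<open>States of a register of qubits\<close>

text \<open>A computational basis state of a register \<open>Q\<close> is a bit assignment \<open>x :: 'q \<Rightarrow> bool\<close> that is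
  \<open>False\<close> outside \<open>Q\<close>. A vector is given by its amplitudes; vectors of the register \<open>Q\<close> have
  amplitude \<open>0\<close> on every assignment that is not a basis state of \<open>Q\<close>. In particular
  the all-zero state is the same function for every register.\<close>

type_synonym 'q qvec = "('q \<Rightarrow> bool) \<Rightarrow> complex"

definition basis :: "'q set \<Rightarrow> ('q \<Rightarrow> bool) set" where
  "basis Q = {x. {q. x q} \<subseteq> Q}"

definition is_state :: "'q set \<Rightarrow> 'q qvec \<Rightarrow> bool" where
  "is_state Q \<psi> \<longleftrightarrow> (\<forall>x. x \<notin> basis Q \<longrightarrow> \<psi> x = 0) \<and> (\<Sum>x\<in>basis Q. (cmod (\<psi> x))\<^sup>2) = 1"

definition zero_state :: "'q qvec" where
  "zero_state = (\<lambda>x. if x = (\<lambda>_. False) then 1 else 0)"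

definition tensor :: "'q set \<Rightarrow> 'q set \<Rightarrow> 'q qvec \<Rightarrow> 'q qvec \<Rightarrow> 'q qvec" where
  "tensor A B \<psi> \<phi> =
     (\<lambda>x. if x \<in> basis (A \<union> B) then \<psi> (\<lambda>q. q \<in> A \<and> x q) * \<phi> (\<lambda>q. q \<in> B \<and> x q) else 0)"

text \<open>The state \<open>\<psi>\<close> of the register \<open>A\<close>, transported along an injective renaming \<open>f\<close> of its qubits.\<close>

definition relabel :: "('q \<Rightarrow> 'r) \<Rightarrow> 'q set \<Rightarrow> 'q qvec \<Rightarrow> 'r qvec" where
  "relabel f A \<psi> = (\<lambda>x. if x \<in> basis (f ` A) then \<psi> (\<lambda>q. q \<in> A \<and> x (f q)) else 0)"


section \<open>Unitary circuits\<close>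

type_synonym gate_matrix = "complex ^ (bool \<times> bool) ^ (bool \<times> bool)"

definition dagger :: "gate_matrix \<Rightarrow> gate_matrix" where
  "dagger M = (\<chi> p q. cnj (M $ q $ p))"

definition unitary_matrix :: "gate_matrix \<Rightarrow> bool" where
  "unitary_matrix M \<longleftrightarrow> M ** dagger M = mat 1 \<and> dagger M ** M = mat 1"

text \<open>A gate consists of the two qubits it acts on and its matrix. A circuit is the list of its
  layers in order of time; a layer is a list of gates.\<close>

type_synonym 'q gate = "'q \<times> 'q \<times> gate_matrix"
type_synonym 'q circuit = "'q gate list list"

fun gate_qubits :: "'q gate \<Rightarrow> 'q set" where
  "gate_qubits (a, b, M) = {a, b}"

definition circuit_qubits :: "'q circuit \<Rightarrow> 'q set" where
  "circuit_qubits C = (\<Union>g\<in>set (concat C). gate_qubits g)"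

fun apply_gate :: "'q gate \<Rightarrow> 'q qvec \<Rightarrow> 'q qvec" where
  "apply_gate (a, b, M) \<psi> =
     (\<lambda>x. \<Sum>p\<in>UNIV. M $ (x a, x b) $ p * \<psi> (x(a := fst p, b := snd p)))"

definition run :: "'q circuit \<Rightarrow> 'q qvec \<Rightarrow> 'q qvec" where
  "run C = fold apply_gate (concat C)"

definition is_layer :: "('q \<times> 'q) set \<Rightarrow> 'q gate list \<Rightarrow> bool" where
  "is_layer E L \<longleftrightarrow>
     (\<forall>(a, b, M)\<in>set L. a \<noteq> b \<and> (a, b) \<in> E \<and> unitary_matrix M) \<and>
     sorted_wrt (\<lambda>g h. gate_qubits g \<inter> gate_qubits h = {}) L"

text \<open>Circuits of depth (at most) \<open>D\<close> whose gates act on neighbours with respect to \<open>E\<close>.\<close>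

definition is_circuit :: "('q \<times> 'q) set \<Rightarrow> nat \<Rightarrow> 'q circuit \<Rightarrow> bool" where
  "is_circuit E D C \<longleftrightarrow> length C \<le> D \<and> (\<forall>L\<in>set C. is_layer E L)"

fun dagger_gate :: "'q gate \<Rightarrow> 'q gate" where
  "dagger_gate (a, b, M) = (a, b, dagger M)"

definition dagger_circuit :: "'q circuit \<Rightarrow> 'q circuit" where
  "dagger_circuit C = rev (map (map dagger_gate) C)"

text \<open>Layer-wise juxtaposition; shorter circuits are padded with empty layers at the end.\<close>

definition parallel :: "'q circuit list \<Rightarrow> 'q circuit" where
  "parallel Cs =
     map (\<lambda>t. concat (map (\<lambda>C. if t < length C then C ! t else []) Cs))
       [0..<fold max (map length Cs) 0]"

definition local_inversion :: "'q set \<Rightarrow> 'q set \<Rightarrow> 'q circuit \<Rightarrow> 'q qvec \<Rightarrow> bool" where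
  "local_inversion Q A V \<psi> \<longleftrightarrow>
     (\<exists>\<phi>. is_state (Q - A) \<phi> \<and> run V \<psi> = tensor A (Q - A) zero_state \<phi>)"


section \<open>Circuits with reset gates\<close>

datatype 'q operation = Unitary "'q gate" | Reset 'q

type_synonym 'q process = "'q operation list list"

text \<open>Density operators are given by their matrix entries.\<close>

type_synonym 'q density = "('q \<Rightarrow> bool) \<Rightarrow> ('q \<Rightarrow> bool) \<Rightarrow> complex"

definition pure :: "'q qvec \<Rightarrow> 'q density" where
  "pure \<psi> = (\<lambda>x y. \<psi> x * cnj (\<psi> y))"

text \<open>A gate \<open>G\<close> sends \<open>\<rho>\<close> to \<open>G \<rho> G\<^sup>\<dagger>\<close>; the inner \<open>apply_gate\<close> below computes
  the entry of \<open>\<rho> G\<^sup>\<dagger>\<close> at \<open>(x', y)\<close>, up to conjugation. A reset traces out \<open>q\<close> and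
  reinitializes it to zero.\<close>

fun apply_operation :: "'q operation \<Rightarrow> 'q density \<Rightarrow> 'q density" where
  "apply_operation (Unitary g) \<rho> =
     (\<lambda>x y. apply_gate g (\<lambda>x'. cnj (apply_gate g (\<lambda>y'. cnj (\<rho> x' y')) y)) x)"
| "apply_operation (Reset q) \<rho> =
     (\<lambda>x y. if x q \<or> y q then 0 else \<Sum>b\<in>UNIV. \<rho> (x(q := b)) (y(q := b)))"

definition run_process :: "'q process \<Rightarrow> 'q density \<Rightarrow> 'q density" where
  "run_process W = fold apply_operation (concat W)"

definition reconstruction_stage ::
  "(nat \<Rightarrow> nat) \<Rightarrow> (nat \<Rightarrow> nat \<Rightarrow> nat set) \<Rightarrow> (nat \<Rightarrow> nat \<Rightarrow> nat circuit) \<Rightarrow> nat \<Rightarrow> nat process" where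
  "reconstruction_stage m S V i =
     map (map Unitary) (parallel (map (\<lambda>j. V i j) [1..<Suc (m i)])) @
     [concat (map (\<lambda>j. map Reset (sorted_list_of_set (S i j))) [1..<Suc (m i)])] @
     map (map Unitary) (parallel (map (\<lambda>j. dagger_circuit (V i j)) [1..<Suc (m i)]))"

definition reconstruction_process ::
  "nat \<Rightarrow> (nat \<Rightarrow> nat) \<Rightarrow> (nat \<Rightarrow> nat \<Rightarrow> nat set) \<Rightarrow> (nat \<Rightarrow> nat \<Rightarrow> nat circuit) \<Rightarrow> nat process" where
  "reconstruction_process l m S V = concat (map (reconstruction_stage m S V) [1..<Suc l])"


section \<open>Backward lightcones\<close>

fun operation_qubits :: "'q operation \<Rightarrow> 'q set" where
  "operation_qubits (Unitary g) = gate_qubits g"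
| "operation_qubits (Reset q) = {q}"

text \<open>Operations in one layer do not overlap, so a wire of the diagram (a connection between two
  consecutive operations on the same qubit) is determined by its qubit \<open>v\<close> and the layer of the
  operation whose output it is: \<open>(v, Some s)\<close> is the wire leaving the operation on \<open>v\<close> in
  layer \<open>s\<close> at the top, and \<open>(v, None)\<close> is the bottom input wire of \<open>v\<close>.
  \<open>source W t v\<close> locates the wire of \<open>v\<close> right below layer \<open>t\<close>; for
  \<open>t = length W\<close> this is the output wire of \<open>v\<close>.\<close>

fun source :: "'q process \<Rightarrow> nat \<Rightarrow> 'q \<Rightarrow> nat option" where
  "source W 0 v = None"
| "source W (Suc t) v =
     (if v \<in> (\<Union>g\<in>set (W ! t). operation_qubits g) then Some t else source W t v)"

definition reset_output :: "'q process \<Rightarrow> 'q \<times> nat option \<Rightarrow> bool" where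
  "reset_output W w \<longleftrightarrow> (\<exists>v s. w = (v, Some s) \<and> s < length W \<and> Reset v \<in> set (W ! s))"

text \<open>The blue wires, for the output wires of the qubits in \<open>Out\<close>.\<close>

inductive blue :: "'q process \<Rightarrow> 'q set \<Rightarrow> 'q \<times> nat option \<Rightarrow> bool" for W Out where
  blue_out: "v \<in> Out \<Longrightarrow> blue W Out (v, source W (length W) v)"
| blue_down: "blue W Out (u, Some t) \<Longrightarrow> t < length W \<Longrightarrow> Unitary g \<in> set (W ! t) \<Longrightarrow>
     u \<in> gate_qubits g \<Longrightarrow> w \<in> gate_qubits g \<Longrightarrow> \<not> reset_output W (w, source W t w) \<Longrightarrow>
     blue W Out (w, source W t w)"

definition green :: "'q process \<Rightarrow> 'q set \<Rightarrow> nat \<Rightarrow> 'q gate \<Rightarrow> bool" where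
  "green W Out t g \<longleftrightarrow> t < length W \<and> Unitary g \<in> set (W ! t) \<and>
     (\<exists>u\<in>gate_qubits g. blue W Out (u, Some t))"

definition reaches_input :: "'q process \<Rightarrow> 'q set \<Rightarrow> bool" where
  "reaches_input W Out \<longleftrightarrow> (\<exists>v. blue W Out (v, None))"

text \<open>A qubit of the lightcone is a whole line of the diagram, running through gates from the bottom
  input or a reset gate up to the next reset gate or the output. The line of \<open>v\<close> passing right
  below layer \<open>t\<close> is \<open>(v, line_start W t v)\<close>, where \<open>line_start W t v\<close> is the
  layer of the reset gate at which it begins (\<open>None\<close> for the bottom input).\<close>

fun line_start :: "'q process \<Rightarrow> nat \<Rightarrow> 'q \<Rightarrow> nat option" where
  "line_start W 0 v = None"
| "line_start W (Suc t) v = (if Reset v \<in> set (W ! t) then Some t else line_start W t v)"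

text \<open>The green gates, keeping the layers of \<open>W\<close> but omitting those without green gates.\<close>

definition lightcone :: "'q process \<Rightarrow> 'q set \<Rightarrow> ('q \<times> nat option) circuit" where
  "lightcone W Out =
     filter (\<lambda>L. L \<noteq> [])
       (map (\<lambda>t. [((a, line_start W t a), (b, line_start W t b), M).
                   Unitary (a, b, M) \<leftarrow> W ! t, green W Out t (a, b, M)])
         [0..<length W])"

definition output_line :: "'q process \<Rightarrow> 'q \<Rightarrow> 'q \<times> nat option" where
  "output_line W v = (v, line_start W (length W) v)"

definition ancillas :: "'q process \<Rightarrow> 'q set \<Rightarrow> ('q \<times> nat option) set" where
  "ancillas W Out = circuit_qubits (lightcone W Out) - output_line W ` Out"

text \<open>Adjacency of lines: those of neighbouring qubits.\<close>

definition line_edges :: "('q \<times> 'q) set \<Rightarrow> (('q \<times> nat option) \<times> ('q \<times> nat option)) set" where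
  "line_edges E = {(p, q). (fst p, fst q) \<in> E}"

end

theory Submission
  imports Defs
begin

text \<open>Assign to every line of the diagram of \<open>W\<close> its own qubit. Every reset of \<open>W\<close> hits a qubit
  that is already in the zero state, so replacing it by a switch to a fresh zero qubit turns \<open>W\<close>
  into a unitary circuit on lines that carries \<open>\<psi>\<close> from the input lines to the output lines.
  A gate outside the lightcone is never followed by a lightcone gate on one of its lines and never
  touches an output line. Hence all such gates can be commuted to the end and undone, at the price
  of a junk state on the remaining lines. Finally the lightcone does not touch the input lines,
  because a wire has travelled at most \<open>(2 * l - 1) * d\<close> steps from its output when
  it meets the reset layer covering the neighbourhood of that output; so the input state
  can be discarded.\<close>

section \<open>Gates and circuits\<close>

text \<open>The obstacle is that the run of \<open>W\<close> starts with \<open>\<psi>\<close> on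
  the input lines, while the lightcone starts from zeros only. Write \<open>C\<close> for the
  lightcone and \<open>N\<close> for the other gates, so that \<open>C\<close> followed by
  \<open>N\<close> moves \<open>\<psi>\<close> from the input lines to the output lines. Undoing
  \<open>N\<close> equates \<open>C\<close> applied to \<open>\<psi>\<close> on the input lines with
  the inverse of \<open>N\<close> applied to \<open>\<psi>\<close> on the output lines.
  \<open>C\<close> avoids the input lines and the inverse of \<open>N\<close> avoids the output
  lines, so on either side the amplitude of \<open>\<psi>\<close> is a factor that the gates cannot
  change; on the left it reads the input bits, on the right the output bits. Fixing the input bits
  at an assignment of nonzero amplitude makes the left factor a constant. What remains writes the
  output of \<open>C\<close> as \<open>\<psi>\<close> on the output lines times a function of the
  ancilla bits. That function, divided by the constant, is the junk state, and unitarity of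
  \<open>C\<close> gives it norm one.\<close>

abbreviation apply_gates :: "'q gate list \<Rightarrow> 'q qvec \<Rightarrow> 'q qvec" where
  "apply_gates \<equiv> fold apply_gate"

definition proper_gate :: "'q gate \<Rightarrow> bool" where
  "proper_gate g \<longleftrightarrow> (case g of (a, b, M) \<Rightarrow> a \<noteq> b \<and> unitary_matrix M)"

definition supported :: "'q set \<Rightarrow> 'q qvec \<Rightarrow> bool" where
  "supported Q \<psi> \<longleftrightarrow> (\<forall>x. x \<notin> basis Q \<longrightarrow> \<psi> x = 0)"

text \<open>In tensor terms, \<open>\<psi>\<close> is the product of the zero state on
  \<open>q\<close> with a vector of the other qubits.\<close>

definition zero_on :: "'q \<Rightarrow> 'q qvec \<Rightarrow> bool" where
  "zero_on q \<psi> \<longleftrightarrow> (\<forall>x. x q \<longrightarrow> \<psi> x = 0)"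

text \<open>In tensor terms, \<open>\<psi>\<close> is the unnormalised sum of all basis states on
  \<open>B\<close>, times a vector of the other qubits. With \<open>- B\<close> in place of
  \<open>B\<close> it says that \<open>\<psi>\<close> reads only bits in \<open>B\<close>.\<close>

definition depends_off :: "'q set \<Rightarrow> 'q qvec \<Rightarrow> bool" where
  "depends_off B \<psi> \<longleftrightarrow> (\<forall>x y. (\<forall>q. q \<notin> B \<longrightarrow> x q = y q) \<longrightarrow> \<psi> x = \<psi> y)"

section \<open>Commutation and inversion of gate lists\<close>

lemma apply_gate_commute:
  assumes "gate_qubits g \<inter> gate_qubits h = {}"
  shows "apply_gate g (apply_gate h \<psi>) = apply_gate h (apply_gate g \<psi>)"
proof -
  obtain a b M where g: "g = (a, b, M)" by (cases g)
  obtain a' b' M' where h: "h = (a', b', M')" by (cases h)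
  have d: "a \<noteq> a'" "a \<noteq> b'" "b \<noteq> a'" "b \<noteq> b'" using assms by (auto simp: g h)
  have upd: "x(a := p, b := q, a' := p', b' := q') = x(a' := p', b' := q', a := p, b := q)"
    for x :: "'a \<Rightarrow> bool" and p q p' q'
    using d by (simp add: fun_upd_twist)
  show ?thesis
  proof
    fix x
    have "apply_gate g (apply_gate h \<psi>) x = (\<Sum>p\<in>UNIV. \<Sum>p'\<in>UNIV. M $ (x a, x b) $ p *
        (M' $ (x a', x b') $ p' * \<psi> (x(a := fst p, b := snd p, a' := fst p', b' := snd p'))))"
      using d by (simp add: g h sum_distrib_left)
    also have "\<dots> = (\<Sum>p'\<in>UNIV. \<Sum>p\<in>UNIV. M $ (x a, x b) $ p *
        (M' $ (x a', x b') $ p' * \<psi> (x(a := fst p, b := snd p, a' := fst p', b' := snd p'))))"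
      by (rule sum.swap)
    also have "\<dots> = (\<Sum>p'\<in>UNIV. \<Sum>p\<in>UNIV. M' $ (x a', x b') $ p' *
        (M $ (x a, x b) $ p * \<psi> (x(a' := fst p', b' := snd p', a := fst p, b := snd p))))"
      by (intro sum.cong refl) (simp only: upd mult.left_commute)
    also have "\<dots> = apply_gate h (apply_gate g \<psi>) x"
      using d by (simp add: g h sum_distrib_left)
    finally show "apply_gate g (apply_gate h \<psi>) x = apply_gate h (apply_gate g \<psi>) x" .
  qed
qed

lemma apply_gate_gates_commute:
  assumes "\<And>h. h \<in> set hs \<Longrightarrow> gate_qubits g \<inter> gate_qubits h = {}"
  shows "apply_gate g (apply_gates hs \<psi>) = apply_gates hs (apply_gate g \<psi>)"
  using assms
  by (induction hs arbitrary: \<psi>) (simp_all add: apply_gate_commute)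

lemma apply_gates_commute:
  assumes "\<And>g h. g \<in> set gs \<Longrightarrow> h \<in> set hs \<Longrightarrow> gate_qubits g \<inter> gate_qubits h = {}"
  shows "apply_gates gs (apply_gates hs \<psi>) = apply_gates hs (apply_gates gs \<psi>)"
  using assms
  by (induction gs arbitrary: \<psi>) (simp_all add: apply_gate_gates_commute)

lemma dagger_mult_entry:
  assumes "unitary_matrix M"
  shows "(\<Sum>p\<in>UNIV. cnj (M $ p $ r) * M $ p $ q) = (if r = q then 1 else 0)"
proof -
  have "(dagger M ** M) $ r $ q = (mat 1 :: gate_matrix) $ r $ q"
    using assms by (simp add: unitary_matrix_def)
  then show ?thesis by (simp add: matrix_matrix_mult_def dagger_def mat_def)
qed

lemma gate_qubits_dagger_gate [simp]: "gate_qubits (dagger_gate g) = gate_qubits g"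
  by (cases g) simp

lemma dagger_dagger [simp]: "dagger (dagger M) = M"
  by (simp add: dagger_def vec_eq_iff)

lemma unitary_matrix_dagger: "unitary_matrix M \<Longrightarrow> unitary_matrix (dagger M)"
  by (simp add: unitary_matrix_def)

lemma dagger_gate_apply_gate:
  assumes "proper_gate g"
  shows "apply_gate (dagger_gate g) (apply_gate g \<psi>) = \<psi>"
proof
  fix x :: "'a \<Rightarrow> bool"
  obtain a b M where g: "g = (a, b, M)" by (cases g)
  have ab: "a \<noteq> b" and M: "unitary_matrix M" using assms by (auto simp: g proper_gate_def)
  define r where "r = (x a, x b)"
  have "apply_gate (dagger_gate g) (apply_gate g \<psi>) x =
      (\<Sum>p\<in>UNIV. \<Sum>q\<in>UNIV. cnj (M $ p $ r) * M $ p $ q * \<psi> (x(a := fst q, b := snd q)))"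
    using ab by (simp add: g dagger_def r_def sum_distrib_left mult.assoc fun_upd_twist)
  also have "\<dots> = (\<Sum>q\<in>UNIV. (\<Sum>p\<in>UNIV. cnj (M $ p $ r) * M $ p $ q) *
      \<psi> (x(a := fst q, b := snd q)))"
    by (subst sum.swap) (simp only: sum_distrib_right)
  also have "\<dots> = (\<Sum>q\<in>UNIV. (if r = q then \<psi> (x(a := fst q, b := snd q)) else 0))"
    by (simp only: dagger_mult_entry [OF M], rule sum.cong) auto
  also have "\<dots> = \<psi> x"
    by (simp add: r_def)
  finally show "apply_gate (dagger_gate g) (apply_gate g \<psi>) x = \<psi> x" .
qed

lemma apply_gates_inverse:
  assumes "\<And>g. g \<in> set gs \<Longrightarrow> proper_gate g"
  shows "apply_gates (rev (map dagger_gate gs)) (apply_gates gs \<psi>) = \<psi>"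
  using assms
  by (induction gs arbitrary: \<psi>) (simp_all add: dagger_gate_apply_gate)

text \<open>\<open>dagger_circuit\<close> reverses the order of the layers but not the order inside
  a layer. Disjointness makes the two orders inside a layer equivalent.\<close>

lemma apply_gates_layer_inverse:
  assumes "sorted_wrt (\<lambda>g h. gate_qubits g \<inter> gate_qubits h = {}) gs"
    and "\<And>g. g \<in> set gs \<Longrightarrow> proper_gate g"
  shows "apply_gates (map dagger_gate gs) (apply_gates gs \<psi>) = \<psi>"
  using assms
proof (induction gs arbitrary: \<psi>)
  case (Cons g gs)
  then show ?case
    by (simp add: apply_gate_gates_commute [of gs "dagger_gate g"] dagger_gate_apply_gate)
qed simp

lemma apply_gates_dagger_circuit:
  assumes "\<And>L. L \<in> set C \<Longrightarrow> is_layer E L"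
  shows "apply_gates (concat (dagger_circuit C)) (apply_gates (concat C) \<psi>) = \<psi>"
  using assms
proof (induction C arbitrary: \<psi>)
  case (Cons L C)
  then have "is_layer E L" by simp
  then have "apply_gates (map dagger_gate L) (apply_gates L \<psi>) = \<psi>" for \<psi>
    by (intro apply_gates_layer_inverse) (auto simp: is_layer_def proper_gate_def)
  with Cons show ?case by (simp add: dagger_circuit_def)
qed (simp add: dagger_circuit_def)

lemma circuit_qubits_dagger_circuit [simp]:
  "circuit_qubits (dagger_circuit C) = circuit_qubits C"
  by (simp add: circuit_qubits_def dagger_circuit_def)

lemma gate_qubits_subset_circuit_qubits:
  "g \<in> set (concat C) \<Longrightarrow> gate_qubits g \<subseteq> circuit_qubits C"
  by (auto simp: circuit_qubits_def)

text \<open>The daggers come in the original order of the circuits, as in a stage of the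
  reconstruction process; circuits on disjoint qubits commute, so this still undoes them.\<close>

lemma apply_gates_dagger_circuits:
  assumes "\<And>C L. C \<in> set Cs \<Longrightarrow> L \<in> set C \<Longrightarrow> is_layer E L"
    and "sorted_wrt (\<lambda>C C'. circuit_qubits C \<inter> circuit_qubits C' = {}) Cs"
  shows "apply_gates (concat (map (concat \<circ> dagger_circuit) Cs))
    (apply_gates (concat (map concat Cs)) \<psi>) = \<psi>"
  using assms
proof (induction Cs arbitrary: \<psi>)
  case (Cons C Cs)
  have "apply_gates (concat (dagger_circuit C)) (apply_gates (concat (map concat Cs)) \<phi>) =
      apply_gates (concat (map concat Cs)) (apply_gates (concat (dagger_circuit C)) \<phi>)" for \<phi>
  proof (rule apply_gates_commute)
    fix g h assume g: "g \<in> set (concat (dagger_circuit C))" and h: "h \<in> set (concat (map concat Cs))"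
    have "gate_qubits g \<subseteq> circuit_qubits C"
      using gate_qubits_subset_circuit_qubits [OF g] by simp
    moreover obtain C' where "C' \<in> set Cs" "gate_qubits h \<subseteq> circuit_qubits C'"
      using h by (auto simp: circuit_qubits_def)
    ultimately show "gate_qubits g \<inter> gate_qubits h = {}" using Cons.prems(2) by fastforce
  qed
  moreover have "apply_gates (concat (dagger_circuit C)) (apply_gates (concat C) \<psi>) = \<psi>"
    using Cons.prems(1) by (intro apply_gates_dagger_circuit) auto
  moreover have "apply_gates (concat (map (concat \<circ> dagger_circuit) Cs))
      (apply_gates (concat (map concat Cs)) \<psi>) = \<psi>"
    using Cons.prems by (intro Cons.IH) auto
  ultimately show ?case by (simp add: o_def)
qed simp

subsection \<open>Support and locality\<close>

lemma basis_update_iff: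
  "a \<in> Q \<Longrightarrow> b \<in> Q \<Longrightarrow> x(a := p, b := q) \<in> basis Q \<longleftrightarrow> x \<in> basis Q"
  by (auto simp: basis_def split: if_splits)

lemma finite_basis: "finite Q \<Longrightarrow> finite (basis Q)"
proof -
  assume "finite Q"
  have "basis Q \<subseteq> (\<lambda>A q. q \<in> A) ` Pow Q"
  proof
    fix x assume "x \<in> basis Q"
    then show "x \<in> (\<lambda>A q. q \<in> A) ` Pow Q"
      by (intro image_eqI [of _ _ "{q. x q}"]) (auto simp: basis_def)
  qed
  with \<open>finite Q\<close> show ?thesis by (meson finite_Pow_iff finite_imageI finite_subset)
qed

lemma supported_apply_gates:
  assumes "supported Q \<psi>" "\<And>g. g \<in> set gs \<Longrightarrow> gate_qubits g \<subseteq> Q"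
  shows "supported Q (apply_gates gs \<psi>)"
  using assms
proof (induction gs arbitrary: \<psi>)
  case (Cons g gs)
  obtain a b M where g: "g = (a, b, M)" by (cases g)
  have "supported Q (apply_gate g \<psi>)"
    using Cons.prems(1) Cons.prems(2)[of g] by (auto simp: g supported_def basis_update_iff)
  with Cons show ?case by simp
qed simp

lemma zero_on_apply_gates:
  assumes "zero_on q \<psi>" "\<And>g. g \<in> set gs \<Longrightarrow> q \<notin> gate_qubits g"
  shows "zero_on q (apply_gates gs \<psi>)"
  using assms
proof (induction gs arbitrary: \<psi>)
  case (Cons g gs)
  obtain a b M where g: "g = (a, b, M)" by (cases g)
  have "zero_on q (apply_gate g \<psi>)"
    using Cons.prems(1) Cons.prems(2)[of g] by (auto simp: g zero_on_def)
  with Cons show ?case by simp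
qed simp

lemma depends_off_apply_gates:
  assumes "depends_off B \<psi>" "\<And>g. g \<in> set gs \<Longrightarrow> gate_qubits g \<inter> B = {}"
  shows "depends_off B (apply_gates gs \<psi>)"
  using assms
proof (induction gs arbitrary: \<psi>)
  case (Cons g gs)
  obtain a b M where g: "g = (a, b, M)" by (cases g)
  have ab: "a \<notin> B" "b \<notin> B" using Cons.prems(2)[of g] by (auto simp: g)
  have "depends_off B (apply_gate g \<psi>)"
    unfolding depends_off_def
  proof (intro allI impI)
    fix x y :: "'a \<Rightarrow> bool" assume xy: "\<forall>q. q \<notin> B \<longrightarrow> x q = y q"
    have "\<psi> (x(a := fst p, b := snd p)) = \<psi> (y(a := fst p, b := snd p))" for p
      using Cons.prems(1) xy by (auto simp: depends_off_def)
    then show "apply_gate g \<psi> x = apply_gate g \<psi> y" using xy ab by (simp add: g)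
  qed
  with Cons show ?case by simp
qed simp

text \<open>The factor \<open>c\<close> reads only bits in \<open>B\<close>, which the gates leave
  alone, so it passes through them like a scalar. For empty \<open>B\<close> this is
  homogeneity.\<close>

lemma apply_gates_mult:
  assumes "depends_off (- B) c" "\<And>g. g \<in> set gs \<Longrightarrow> gate_qubits g \<inter> B = {}"
  shows "apply_gates gs (\<lambda>x. c x * \<psi> x) = (\<lambda>x. c x * apply_gates gs \<psi> x)"
  using assms(2)
proof (induction gs arbitrary: \<psi>)
  case (Cons g gs)
  obtain a b M where g: "g = (a, b, M)" by (cases g)
  have "c (x(a := p, b := q)) = c x" for x p q
    using assms(1) Cons.prems[of g] by (auto simp: depends_off_def g)
  then have "apply_gate g (\<lambda>x. c x * \<psi> x) = (\<lambda>x. c x * apply_gate g \<psi> x)"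
    by (simp add: g sum_distrib_left mult.left_commute)
  with Cons show ?case by simp
qed simp

lemma apply_gates_relabel:
  assumes "inj_on f Q" "\<And>g. g \<in> set gs \<Longrightarrow> gate_qubits g \<subseteq> Q"
  shows "apply_gates (map (\<lambda>(a, b, M). (f a, f b, M)) gs) (relabel f Q \<psi>) =
    relabel f Q (apply_gates gs \<psi>)"
  using assms(2)
proof (induction gs arbitrary: \<psi>)
  case (Cons g gs)
  obtain a b M where g: "g = (a, b, M)" by (cases g)
  have ab: "a \<in> Q" "b \<in> Q" using Cons.prems[of g] by (auto simp: g)
  have "(\<lambda>q. q \<in> Q \<and> (x(f a := p, f b := r)) (f q)) = (\<lambda>q. q \<in> Q \<and> x (f q))(a := p, b := r)"
    for x p r
    using ab assms(1) by (auto simp: fun_eq_iff inj_on_def)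
  then have "apply_gate (f a, f b, M) (relabel f Q \<psi>) = relabel f Q (apply_gate g \<psi>)"
    using ab by (auto simp: g relabel_def basis_update_iff simp del: fun_upd_apply)
  with Cons show ?case by (simp add: g)
qed simp

text \<open>An assignment with a one on the image of \<open>Q - B\<close> gets amplitude zero on
  both sides: on the left by the hypothesis, on the right because it leaves the register.
  Injectivity keeps that image apart from the image of \<open>B\<close>.\<close>

lemma relabel_subset:
  assumes "B \<subseteq> Q" "inj_on f Q" "\<And>q. q \<in> Q - B \<Longrightarrow> zero_on q \<psi>"
  shows "relabel f Q \<psi> = relabel f B \<psi>"
proof
  fix x :: "'b \<Rightarrow> bool"
  show "relabel f Q \<psi> x = relabel f B \<psi> x"
  proof (cases "x \<in> basis (f ` B)")
    case True
    have "q \<in> B" if "q \<in> Q" "x (f q)" for q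
    proof -
      from True that(2) obtain r where "r \<in> B" "f q = f r" by (auto simp: basis_def)
      with that(1) assms(1,2) show ?thesis by (metis inj_onD subsetD)
    qed
    with assms(1) have "(\<lambda>q. q \<in> Q \<and> x (f q)) = (\<lambda>q. q \<in> B \<and> x (f q))"
      by auto
    with True assms(1) show ?thesis by (auto simp: relabel_def basis_def)
  next
    case False
    have "\<psi> (\<lambda>q. q \<in> Q \<and> x (f q)) = 0" if "x \<in> basis (f ` Q)"
    proof -
      have "f ` (Q - B) \<inter> {r. x r} \<noteq> {}" using that False by (auto simp: basis_def)
      then obtain q where "q \<in> Q - B" "x (f q)" by blast
      with assms(3)[of q] show ?thesis by (auto simp: zero_on_def)
    qed
    with False show ?thesis by (simp add: relabel_def)
  qed
qed

text \<open>This turns a trivial reset into a switch of lines: a qubit in the zero state may change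
  its name freely, because every qubit outside the register reads zero as well. Both sides reduce to
  the qubits on which the renamings agree.\<close>

lemma relabel_cong_zero_on:
  assumes "inj_on f Q" "inj_on f' Q" "\<And>q. q \<in> Q \<Longrightarrow> f q \<noteq> f' q \<Longrightarrow> zero_on q \<psi>"
  shows "relabel f Q \<psi> = relabel f' Q \<psi>"
proof -
  let ?B = "{q \<in> Q. f q = f' q}"
  have "relabel f Q \<psi> = relabel f ?B \<psi>" using assms by (intro relabel_subset) auto
  also have "\<dots> = relabel f' ?B \<psi>"
  proof -
    have "f ` ?B = f' ` ?B" by force
    moreover have "(\<lambda>q. q \<in> ?B \<and> x (f q)) = (\<lambda>q. q \<in> ?B \<and> x (f' q))" for x by auto
    ultimately show ?thesis unfolding relabel_def by presburger
  qed
  also have "\<dots> = relabel f' Q \<psi>" using assms by (intro relabel_subset [symmetric]) auto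
  finally show ?thesis .
qed

subsection \<open>Norms\<close>

lemma unitary_matrix_isometry:
  assumes "unitary_matrix M"
  shows "(\<Sum>r\<in>UNIV. (cmod (\<Sum>p\<in>UNIV. M $ r $ p * v p))\<^sup>2) = (\<Sum>p\<in>UNIV. (cmod (v p))\<^sup>2)"
proof -
  have "complex_of_real (\<Sum>r\<in>UNIV. (cmod (\<Sum>p\<in>UNIV. M $ r $ p * v p))\<^sup>2) =
      (\<Sum>r\<in>UNIV. \<Sum>p\<in>UNIV. \<Sum>q\<in>UNIV. M $ r $ p * v p * cnj (M $ r $ q * v q))"
    by (simp only: of_real_sum complex_norm_square cnj_sum sum_product)
  also have "\<dots> = (\<Sum>p\<in>UNIV. \<Sum>r\<in>UNIV. \<Sum>q\<in>UNIV. M $ r $ p * v p * cnj (M $ r $ q * v q))"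
    by (rule sum.swap)
  also have "\<dots> = (\<Sum>p\<in>UNIV. \<Sum>q\<in>UNIV. \<Sum>r\<in>UNIV. M $ r $ p * v p * cnj (M $ r $ q * v q))"
    by (intro sum.cong refl sum.swap)
  also have "\<dots> = (\<Sum>p\<in>UNIV. \<Sum>q\<in>UNIV. v p * cnj (v q) *
      (\<Sum>r\<in>UNIV. cnj (M $ r $ q) * M $ r $ p))"
    by (simp add: sum_distrib_left mult_ac)
  also have "\<dots> = (\<Sum>p\<in>UNIV. \<Sum>q\<in>UNIV. if q = p then v p * cnj (v q) else 0)"
    unfolding dagger_mult_entry [OF assms] by (intro sum.cong refl) auto
  also have "\<dots> = (\<Sum>p\<in>UNIV. v p * cnj (v p))"
    by simp
  also have "\<dots> = complex_of_real (\<Sum>p\<in>UNIV. (cmod (v p))\<^sup>2)"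
    by (simp only: of_real_sum complex_norm_square)
  finally show ?thesis unfolding of_real_eq_iff .
qed

text \<open>Groups the amplitudes into blocks of four, on each of which a gate on \<open>a\<close>
  and \<open>b\<close> acts as its matrix. Norm preservation then follows block by block.\<close>

lemma sum_basis_pair:
  fixes F :: "('q \<Rightarrow> bool) \<Rightarrow> 'a::comm_monoid_add"
  assumes "a \<in> Q" "b \<in> Q" "a \<noteq> b"
  shows "(\<Sum>x\<in>basis Q. F x) =
    (\<Sum>y\<in>basis (Q - {a, b}). \<Sum>r\<in>UNIV. F (y(a := fst r, b := snd r)))"
  unfolding sum.cartesian_product
proof (rule sum.reindex_bij_witness
    [where i = "\<lambda>(y, r). y(a := fst r, b := snd r)"
      and j = "\<lambda>x. (x(a := False, b := False), (x a, x b))"])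
  fix z :: "('q \<Rightarrow> bool) \<times> (bool \<times> bool)"
  assume "z \<in> basis (Q - {a, b}) \<times> UNIV"
  moreover obtain y p q where z: "z = (y, (p, q))" by (metis surj_pair)
  ultimately have y: "{c. y c} \<subseteq> Q - {a, b}" by (simp add: basis_def)
  then have "\<not> y a" "\<not> y b" by auto
  then have "y(a := False, b := False) = y" by (simp add: fun_upd_idem)
  then show "(\<lambda>x. (x(a := False, b := False), (x a, x b)))
      ((\<lambda>(y, r). y(a := fst r, b := snd r)) z) = z"
    using assms by (simp add: z fun_upd_twist)
  show "(\<lambda>(y, r). y(a := fst r, b := snd r)) z \<in> basis Q"
    using y assms by (auto simp: z basis_def split: if_splits)
next
  fix x assume x: "x \<in> basis Q"
  show "(x(a := False, b := False), (x a, x b)) \<in> basis (Q - {a, b}) \<times> UNIV"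
    using x by (auto simp: basis_def split: if_splits)
qed (use assms in \<open>simp_all add: fun_upd_twist\<close>)

lemma is_state_apply_gates:
  assumes "is_state Q \<psi>" "\<And>g. g \<in> set gs \<Longrightarrow> gate_qubits g \<subseteq> Q"
    and "\<And>g. g \<in> set gs \<Longrightarrow> proper_gate g"
  shows "is_state Q (apply_gates gs \<psi>)"
  using assms
proof (induction gs arbitrary: \<psi>)
  case (Cons g gs)
  obtain a b M where g: "g = (a, b, M)" by (cases g)
  have ab: "a \<in> Q" "b \<in> Q" "a \<noteq> b" and M: "unitary_matrix M"
    using Cons.prems(2,3)[of g] by (auto simp: g proper_gate_def)
  have "supported Q (apply_gates [g] \<psi>)"
    using Cons.prems(1) Cons.prems(2)[of g]
    by (intro supported_apply_gates) (auto simp: supported_def is_state_def)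
  moreover have "(\<Sum>x\<in>basis Q. (cmod (apply_gate g \<psi> x))\<^sup>2) = (\<Sum>x\<in>basis Q. (cmod (\<psi> x))\<^sup>2)"
    unfolding sum_basis_pair [OF ab]
  proof (rule sum.cong)
    fix y
    have "(\<Sum>r\<in>UNIV. (cmod (apply_gate g \<psi> (y(a := fst r, b := snd r))))\<^sup>2) =
        (\<Sum>r\<in>UNIV. (cmod (\<Sum>p\<in>UNIV. M $ r $ p * \<psi> (y(a := fst p, b := snd p))))\<^sup>2)"
      using ab by (simp add: g fun_upd_twist)
    also have "\<dots> = (\<Sum>r\<in>UNIV. (cmod (\<psi> (y(a := fst r, b := snd r))))\<^sup>2)"
      by (rule unitary_matrix_isometry [OF M])
    finally show "(\<Sum>r\<in>UNIV. (cmod (apply_gate g \<psi> (y(a := fst r, b := snd r))))\<^sup>2) =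
        (\<Sum>r\<in>UNIV. (cmod (\<psi> (y(a := fst r, b := snd r))))\<^sup>2)" .
  qed simp
  ultimately have "is_state Q (apply_gate g \<psi>)"
    using Cons.prems(1) by (simp add: is_state_def supported_def)
  with Cons show ?case by simp
qed simp

lemma is_state_zero_state: "finite Q \<Longrightarrow> is_state Q zero_state"
proof -
  assume "finite Q"
  have "(\<lambda>_. False) \<in> basis Q" by (simp add: basis_def)
  moreover have "(\<Sum>x\<in>basis Q. (cmod (zero_state x))\<^sup>2) =
      (\<Sum>x\<in>basis Q. if (\<lambda>_. False) = x then 1 else 0)"
    by (rule sum.cong) (auto simp: zero_state_def)
  ultimately show ?thesis
    using finite_basis [OF \<open>finite Q\<close>]
    by (auto simp: is_state_def zero_state_def sum.delta)
qed

lemma norm_relabel: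
  assumes "inj_on f Q"
  shows "(\<Sum>x\<in>basis (f ` Q). (cmod (relabel f Q \<psi> x))\<^sup>2) = (\<Sum>x\<in>basis Q. (cmod (\<psi> x))\<^sup>2)"
proof (rule sum.reindex_bij_witness
    [where i = "\<lambda>y r. r \<in> f ` Q \<and> y (the_inv_into Q f r)" and j = "\<lambda>x q. q \<in> Q \<and> x (f q)"])
  fix x assume "x \<in> basis (f ` Q)"
  then show "(\<lambda>r. r \<in> f ` Q \<and> (\<lambda>q. q \<in> Q \<and> x (f q)) (the_inv_into Q f r)) = x"
    using assms by (auto simp: basis_def fun_eq_iff the_inv_into_f_f)
next
  fix y assume "y \<in> basis Q"
  then show "(\<lambda>q. q \<in> Q \<and> f q \<in> f ` Q \<and> y (the_inv_into Q f (f q))) = y"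
    using assms by (auto simp: basis_def fun_eq_iff the_inv_into_f_f dest: inj_onD)
qed (auto simp: basis_def relabel_def)

lemma norm_tensor:
  assumes "A \<inter> B = {}"
  shows "(\<Sum>x\<in>basis (A \<union> B). (cmod (tensor A B \<psi> \<phi> x))\<^sup>2) =
    (\<Sum>x\<in>basis A. (cmod (\<psi> x))\<^sup>2) * (\<Sum>x\<in>basis B. (cmod (\<phi> x))\<^sup>2)"
  unfolding sum_product sum.cartesian_product
  by (rule sum.reindex_bij_witness [where i = "\<lambda>(y, z) q. y q \<or> z q"
        and j = "\<lambda>x. (\<lambda>q. q \<in> A \<and> x q, \<lambda>q. q \<in> B \<and> x q)"])
    (use assms in \<open>auto simp: basis_def fun_eq_iff tensor_def norm_mult power_mult_distrib\<close>)

subsection \<open>Parallel composition\<close>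

lemma sorted_wrt_concat:
  assumes "\<And>xs. xs \<in> set xss \<Longrightarrow> sorted_wrt P xs"
    and "sorted_wrt (\<lambda>xs ys. \<forall>x\<in>set xs. \<forall>y\<in>set ys. P x y) xss"
  shows "sorted_wrt P (concat xss)"
  using assms by (induction xss) (auto simp: sorted_wrt_append)

lemma fold_max_le_iff:
  "fold max xs (a :: 'a :: linorder) \<le> b \<longleftrightarrow> a \<le> b \<and> (\<forall>x\<in>set xs. x \<le> b)"
  by (induction xs arbitrary: a) auto

lemma length_parallel_le: "length (parallel Cs) \<le> d \<longleftrightarrow> (\<forall>C\<in>set Cs. length C \<le> d)"
  by (simp add: parallel_def fold_max_le_iff)

text \<open>Each \<open>R t\<close> can be postponed past all later \<open>P s\<close>, so two
  circuits run side by side may be run one after the other.\<close>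

lemma apply_gates_interleave:
  assumes "\<And>s t g h. s \<in> set ts \<Longrightarrow> t \<in> set ts \<Longrightarrow> g \<in> set (P s) \<Longrightarrow> h \<in> set (R t) \<Longrightarrow>
    gate_qubits g \<inter> gate_qubits h = {}"
  shows "apply_gates (concat (map (\<lambda>t. P t @ R t) ts)) \<psi> =
    apply_gates (concat (map R ts)) (apply_gates (concat (map P ts)) \<psi>)"
  using assms
proof (induction ts arbitrary: \<psi>)
  case (Cons t ts)
  have "apply_gates (concat (map (\<lambda>t. P t @ R t) ts)) \<phi> =
      apply_gates (concat (map R ts)) (apply_gates (concat (map P ts)) \<phi>)" for \<phi>
    by (rule Cons.IH, rule Cons.prems) auto
  moreover have "apply_gates (concat (map P ts)) (apply_gates (R t) \<phi>) =
      apply_gates (R t) (apply_gates (concat (map P ts)) \<phi>)" for \<phi>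
  proof (rule apply_gates_commute)
    fix g h assume "g \<in> set (concat (map P ts))" and h: "h \<in> set (R t)"
    then obtain s where "s \<in> set ts" "g \<in> set (P s)" by auto
    then show "gate_qubits g \<inter> gate_qubits h = {}"
      using h by (intro Cons.prems [of s t]) auto
  qed
  ultimately show ?case by simp
qed simp

lemma concat_padded:
  "length C \<le> T \<Longrightarrow> concat (map (\<lambda>t. if t < length C then C ! t else []) [0..<T]) = concat C"
proof (induction T)
  case (Suc T)
  show ?case
  proof (cases "length C = Suc T")
    case True
    then have "map (\<lambda>t. if t < length C then C ! t else []) [0..<Suc T] = C"
      by (intro nth_equalityI) (auto simp del: upt_Suc)
    then show ?thesis by simp
  qed (use Suc in auto)
qed simp

lemma concat_map_Nil: "concat (map (\<lambda>t. []) ts) = []"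
  by (induction ts) auto

lemma apply_gates_parallel:
  assumes "sorted_wrt (\<lambda>C C'. circuit_qubits C \<inter> circuit_qubits C' = {}) Cs"
  shows "apply_gates (concat (parallel Cs)) \<psi> = apply_gates (concat (map concat Cs)) \<psi>"
proof -
  let ?lay = "\<lambda>C t. if t < length C then C ! t else []"
  \<comment> \<open>The padding length stays fixed during the induction on the list of circuits,
    since the tail may have a smaller maximum; only the bound on the lengths is used.\<close>
  define T where "T = fold max (map length Cs) 0"
  have T: "\<forall>C\<in>set Cs. length C \<le> T"
    using fold_max_le_iff [of "map length Cs" 0 T] by (simp add: T_def)
  have "apply_gates (concat (map (\<lambda>t. concat (map (\<lambda>C. ?lay C t) Cs)) [0..<T])) \<psi> =
      apply_gates (concat (map concat Cs)) \<psi>"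
    using T assms
  proof (induction Cs arbitrary: \<psi>)
    case Nil
    then show ?case by (simp add: concat_map_Nil)
  next
    case (Cons C Cs)
    have "apply_gates (concat (map (\<lambda>t. ?lay C t @ concat (map (\<lambda>C. ?lay C t) Cs)) [0..<T])) \<psi> =
        apply_gates (concat (map (\<lambda>t. concat (map (\<lambda>C. ?lay C t) Cs)) [0..<T]))
          (apply_gates (concat (map (?lay C) [0..<T])) \<psi>)"
    proof (rule apply_gates_interleave)
      fix s t g h
      assume g: "g \<in> set (?lay C s)" and "h \<in> set (concat (map (\<lambda>C. ?lay C t) Cs))"
      then obtain C' where C': "C' \<in> set Cs" and h: "h \<in> set (?lay C' t)"
        unfolding set_concat set_map by blast
      have "g \<in> set (concat C)" "h \<in> set (concat C')"
        using g h by (auto split: if_splits)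
      then have "gate_qubits g \<subseteq> circuit_qubits C" "gate_qubits h \<subseteq> circuit_qubits C'"
        by (blast dest: gate_qubits_subset_circuit_qubits)+
      moreover have "circuit_qubits C \<inter> circuit_qubits C' = {}" using C' Cons.prems(2) by simp
      ultimately show "gate_qubits g \<inter> gate_qubits h = {}" by blast
    qed
    also have "apply_gates (concat (map (?lay C) [0..<T])) \<psi> = apply_gates (concat C) \<psi>"
      using Cons.prems(1) by (simp add: concat_padded)
    also have "apply_gates (concat (map (\<lambda>t. concat (map (\<lambda>C. ?lay C t) Cs)) [0..<T]))
        (apply_gates (concat C) \<psi>) = apply_gates (concat (map concat Cs)) (apply_gates (concat C) \<psi>)"
      using Cons.prems by (intro Cons.IH) auto
    finally show ?case by simp
  qed
  then show ?thesis by (simp add: parallel_def T_def)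
qed

lemma is_circuit_parallel:
  assumes "\<And>C. C \<in> set Cs \<Longrightarrow> is_circuit E d C"
    and "sorted_wrt (\<lambda>C C'. circuit_qubits C \<inter> circuit_qubits C' = {}) Cs"
  shows "is_circuit E d (parallel Cs)"
  unfolding is_circuit_def
proof (intro conjI ballI)
  show "length (parallel Cs) \<le> d"
    using assms(1) by (simp add: length_parallel_le is_circuit_def)
  fix L assume "L \<in> set (parallel Cs)"
  then obtain t where L: "L = concat (map (\<lambda>C. if t < length C then C ! t else []) Cs)"
    by (auto simp: parallel_def)
  have lay: "is_layer E (if t < length C then C ! t else [])" if "C \<in> set Cs" for C
    using assms(1) [OF that] by (auto simp: is_circuit_def is_layer_def)
  have "sorted_wrt (\<lambda>g h. gate_qubits g \<inter> gate_qubits h = {}) L"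
    unfolding L
  proof (rule sorted_wrt_concat)
    show "sorted_wrt (\<lambda>g h. gate_qubits g \<inter> gate_qubits h = {}) gs"
      if gs: "gs \<in> set (map (\<lambda>C. if t < length C then C ! t else []) Cs)" for gs
    proof -
      obtain C where "C \<in> set Cs" "gs = (if t < length C then C ! t else [])"
        using gs by (auto simp only: set_map)
      with lay [of C] show ?thesis unfolding is_layer_def by blast
    qed
    show "sorted_wrt (\<lambda>gs hs. \<forall>g\<in>set gs. \<forall>h\<in>set hs. gate_qubits g \<inter> gate_qubits h = {})
        (map (\<lambda>C. if t < length C then C ! t else []) Cs)"
      unfolding sorted_wrt_map
    proof (rule sorted_wrt_mono_rel [OF _ assms(2)])
      fix C C' :: "'a circuit" assume disj: "circuit_qubits C \<inter> circuit_qubits C' = {}"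
      have "gate_qubits g \<subseteq> circuit_qubits B"
        if "g \<in> set (if t < length B then B ! t else [])" for g and B :: "'a circuit"
        using that by (intro gate_qubits_subset_circuit_qubits) (auto split: if_splits)
      with disj show "\<forall>g\<in>set (if t < length C then C ! t else []).
          \<forall>h\<in>set (if t < length C' then C' ! t else []). gate_qubits g \<inter> gate_qubits h = {}"
        by blast
    qed
  qed
  moreover have "\<forall>(a, b, M)\<in>set L. a \<noteq> b \<and> (a, b) \<in> E \<and> unitary_matrix M"
  proof (rule ballI)
    fix g assume "g \<in> set L"
    then obtain C where C: "C \<in> set Cs" and g: "g \<in> set (if t < length C then C ! t else [])"
      by (auto simp: L)
    from lay [OF C] g show "case g of (a, b, M) \<Rightarrow> a \<noteq> b \<and> (a, b) \<in> E \<and> unitary_matrix M"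
      unfolding is_layer_def by blast
  qed
  ultimately show "is_layer E L" by (simp add: is_layer_def)
qed

lemma is_layer_dagger: "is_layer E L \<Longrightarrow> is_layer E (map dagger_gate L)"
  by (auto simp: is_layer_def sorted_wrt_map unitary_matrix_dagger)

lemma is_circuit_dagger_circuit: "is_circuit E d C \<Longrightarrow> is_circuit E d (dagger_circuit C)"
  by (auto simp: is_circuit_def dagger_circuit_def is_layer_dagger)

section \<open>Processes whose resets act trivially\<close>

text \<open>In a process all of whose resets act on qubits that are already in the zero state,
  the state stays pure and the resets can be skipped.\<close>

fun skip_reset :: "'q operation \<Rightarrow> 'q qvec \<Rightarrow> 'q qvec" where
  "skip_reset (Unitary g) \<psi> = apply_gate g \<psi>"
| "skip_reset (Reset q) \<psi> = \<psi>"

fun resets_trivial :: "'q operation list \<Rightarrow> 'q qvec \<Rightarrow> bool" where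
  "resets_trivial [] \<psi> \<longleftrightarrow> True"
| "resets_trivial (Unitary g # ops) \<psi> \<longleftrightarrow> resets_trivial ops (apply_gate g \<psi>)"
| "resets_trivial (Reset q # ops) \<psi> \<longleftrightarrow> zero_on q \<psi> \<and> resets_trivial ops \<psi>"

lemma resets_trivial_append:
  "resets_trivial (xs @ ys) \<psi> \<longleftrightarrow> resets_trivial xs \<psi> \<and> resets_trivial ys (fold skip_reset xs \<psi>)"
  by (induction xs \<psi> rule: resets_trivial.induct) auto

lemma resets_trivial_map_Unitary [simp]: "resets_trivial (map Unitary gs) \<psi>"
  by (induction gs arbitrary: \<psi>) auto

lemma resets_trivial_map_Reset [simp]:
  "resets_trivial (map Reset qs) \<psi> \<longleftrightarrow> (\<forall>q\<in>set qs. zero_on q \<psi>)"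
  by (induction qs) auto

lemma fold_skip_reset_map_Unitary [simp]: "fold skip_reset (map Unitary gs) \<psi> = apply_gates gs \<psi>"
  by (induction gs arbitrary: \<psi>) auto

lemma fold_skip_reset_map_Reset [simp]: "fold skip_reset (map Reset qs) \<psi> = \<psi>"
  by (induction qs) auto

lemma apply_operation_Unitary_pure:
  "apply_operation (Unitary g) (pure \<psi>) = pure (apply_gate g \<psi>)"
proof -
  have scale: "apply_gate g (\<lambda>x. c * \<phi> x) = (\<lambda>x. c * apply_gate g \<phi> x)" for c \<phi>
    using apply_gates_mult [of "{}" "\<lambda>_. c" "[g]" \<phi>] by (simp add: depends_off_def)
  show ?thesis
    by (simp add: pure_def scale mult.commute [of "\<psi> _"]) (simp only: mult.commute)
qed

lemma apply_operation_Reset_pure: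
  assumes "zero_on q \<psi>"
  shows "apply_operation (Reset q) (pure \<psi>) = pure \<psi>"
proof (intro ext)
  fix x y
  have z: "\<psi> u = 0" if "u q" for u using assms that by (simp add: zero_on_def)
  show "apply_operation (Reset q) (pure \<psi>) x y = pure \<psi> x y"
    by (cases "x q"; cases "y q") (auto simp: pure_def z UNIV_bool fun_upd_idem)
qed

lemma fold_apply_operation_pure:
  "resets_trivial ops \<psi> \<Longrightarrow>
    fold apply_operation ops (pure \<psi>) = pure (fold skip_reset ops \<psi>)"
  by (induction ops \<psi> rule: resets_trivial.induct)
    (simp_all del: apply_operation.simps
      add: apply_operation_Unitary_pure apply_operation_Reset_pure)

section \<open>The diagram of a process\<close>

definition unitaries :: "'q operation list \<Rightarrow> 'q gate list" where
  "unitaries L = [g. Unitary g \<leftarrow> L]"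

lemma unitaries_simps [simp]:
  "unitaries [] = []"
  "unitaries (Unitary g # L) = g # unitaries L"
  "unitaries (Reset q # L) = unitaries L"
  "unitaries (map Unitary gs) = gs"
  "unitaries (map Reset qs) = []"
  by (simp_all add: unitaries_def) (induction gs; simp; induction qs; simp)+

lemma set_unitaries [simp]: "g \<in> set (unitaries L) \<longleftrightarrow> Unitary g \<in> set L"
proof (induction L)
  case (Cons op L)
  then show ?case by (cases op) auto
qed simp

text \<open>The layer travels with the gate because it decides on which lines the gate acts and
  whether the gate is green.\<close>

definition timed_gates :: "'q process \<Rightarrow> nat \<Rightarrow> (nat \<times> 'q gate) list" where
  "timed_gates W T = concat (map (\<lambda>t. map (Pair t) (unitaries (W ! t))) [0..<T])"

fun lift_gate :: "'q process \<Rightarrow> nat \<times> 'q gate \<Rightarrow> ('q \<times> nat option) gate" where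
  "lift_gate W (t, (a, b, M)) = ((a, line_start W t a), (b, line_start W t b), M)"

lemma timed_gates_0 [simp]: "timed_gates W 0 = []"
  by (simp add: timed_gates_def)

lemma timed_gates_Suc [simp]:
  "timed_gates W (Suc t) = timed_gates W t @ map (Pair t) (unitaries (W ! t))"
  by (simp add: timed_gates_def)

lemma set_timed_gates: "(t, g) \<in> set (timed_gates W T) \<longleftrightarrow> t < T \<and> Unitary g \<in> set (W ! t)"
  by (induction T) (auto simp: less_Suc_eq)

lemma gate_qubits_lift_gate:
  "gate_qubits (lift_gate W (t, g)) = (\<lambda>a. (a, line_start W t a)) ` gate_qubits g"
  by (cases g) auto

lemma proper_gate_lift_gate: "proper_gate g \<Longrightarrow> proper_gate (lift_gate W (t, g))"
  by (cases g) (auto simp: proper_gate_def)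

lemma lightcone_layer:
  "[((a, line_start W t a), (b, line_start W t b), M).
      Unitary (a, b, M) \<leftarrow> L, green W Out t (a, b, M)] =
    map (lift_gate W) (map (Pair t) (filter (green W Out t) (unitaries L)))"
proof (induction L)
  case (Cons op L)
  show ?case
  proof (cases op)
    case (Unitary g)
    with Cons show ?thesis by (cases g) auto
  qed (use Cons in auto)
qed simp

lemma lightcone_eq:
  "lightcone W Out = filter (\<lambda>L. L \<noteq> [])
    (map (\<lambda>t. map (lift_gate W) (map (Pair t) (filter (green W Out t) (unitaries (W ! t)))))
      [0..<length W])"
  unfolding lightcone_def lightcone_layer ..

lemma concat_filter_neq_Nil: "concat (filter (\<lambda>xs. xs \<noteq> []) xss) = concat xss"
  by (induction xss) auto

lemma concat_lightcone:
  "concat (lightcone W Out) =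
    map (lift_gate W) (filter (\<lambda>(t, g). green W Out t g) (timed_gates W (length W)))"
proof -
  have "concat (map (\<lambda>t. map (lift_gate W) (map (Pair t) (filter (green W Out t) (unitaries (W ! t)))))
      [0..<T]) = map (lift_gate W) (filter (\<lambda>(t, g). green W Out t g) (timed_gates W T))" for T
    by (induction T) (simp_all add: filter_map o_def)
  then show ?thesis by (simp only: lightcone_eq concat_filter_neq_Nil)
qed

text \<open>Moving the gates outside \<open>P\<close> to the end swaps only pairs in which such a
  gate precedes one in \<open>P\<close>. All other pairs keep their order, so nothing is asked of
  them.\<close>

lemma apply_gates_partition:
  assumes "sorted_wrt (\<lambda>e e'. \<not> P e \<longrightarrow> P e' \<longrightarrow> gate_qubits (f e) \<inter> gate_qubits (f e') = {}) es"
  shows "apply_gates (map f es) \<psi> =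
    apply_gates (map f (filter (\<lambda>e. \<not> P e) es)) (apply_gates (map f (filter P es)) \<psi>)"
  using assms
proof (induction es arbitrary: \<psi>)
  case (Cons e es)
  show ?case
  proof (cases "P e")
    case False
    have "apply_gate (f e) (apply_gates (map f (filter P es)) \<psi>) =
        apply_gates (map f (filter P es)) (apply_gate (f e) \<psi>)"
    proof (rule apply_gate_gates_commute)
      fix h assume "h \<in> set (map f (filter P es))"
      with False Cons.prems show "gate_qubits (f e) \<inter> gate_qubits h = {}"
        by (auto simp del: gate_qubits.simps)
    qed
    with False Cons show ?thesis by simp
  qed (use Cons in simp)
qed simp

section \<open>Lines and wires of the diagram\<close>

lemma line_start_less: "line_start W t a = Some s \<Longrightarrow> s < t"
  by (induction t) (auto split: if_splits simp: less_Suc_eq)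

lemma line_start_reset: "line_start W t a = Some s \<Longrightarrow> Reset a \<in> set (W ! s)"
  by (induction t) (auto split: if_splits)

lemma line_start_ge:
  assumes "Reset a \<in> set (W ! r)" "r < t"
  obtains s where "line_start W t a = Some s" "r \<le> s"
proof -
  have "\<exists>s. line_start W t a = Some s \<and> r \<le> s"
    using assms(2) by (induction t) (use assms(1) in \<open>auto simp: less_Suc_eq\<close>)
  then show ?thesis using that by blast
qed

text \<open>A reset in layer \<open>s\<close> would make the line below \<open>t'\<close> begin at
  \<open>s\<close> or later, whereas the line below \<open>t\<close> begins before
  \<open>t\<close>.\<close>

lemma line_start_eq_imp_no_reset:
  assumes "line_start W t a = line_start W t' a" "t \<le> s" "s < t'"
  shows "Reset a \<notin> set (W ! s)"
proof
  assume "Reset a \<in> set (W ! s)"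
  then obtain s' where "line_start W t' a = Some s'" "s \<le> s'"
    using assms(3) by (rule line_start_ge)
  with assms(1,2) line_start_less [of W t a s'] show False by simp
qed

lemma source_less: "source W t v = Some s \<Longrightarrow> s < t"
  by (induction t) (auto split: if_splits simp: less_Suc_eq)

lemma source_ge:
  assumes "op \<in> set (W ! r)" "v \<in> operation_qubits op" "r < t"
  obtains s where "source W t v = Some s" "r \<le> s"
proof -
  have "\<exists>s. source W t v = Some s \<and> r \<le> s"
    using assms(3) by (induction t) (use assms(1,2) in \<open>auto simp: less_Suc_eq\<close>)
  then show ?thesis using that by blast
qed

text \<open>Where no reset interrupts the line of \<open>a\<close>, each gate met on the way down
  has a blue wire on top and therefore colours the wire of \<open>a\<close> below it. The descent
  ends on top of the gate in layer \<open>t\<close>.\<close>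

lemma blue_propagates_down:
  assumes "blue W Out (a, source W t' a)" "t < t'" "t' \<le> length W"
    and "Unitary g \<in> set (W ! t)" "a \<in> gate_qubits g"
    and "\<And>s. t \<le> s \<Longrightarrow> s < t' \<Longrightarrow> Reset a \<notin> set (W ! s)"
  shows "blue W Out (a, Some t)"
  using assms(1,2,3,6)
proof (induction t')
  case (Suc t')
  show ?case
  proof (cases "a \<in> (\<Union>op\<in>set (W ! t'). operation_qubits op)")
    case True
    then have blue: "blue W Out (a, Some t')" using Suc.prems(1) by simp
    show ?thesis
    proof (cases "t' = t")
      case False
      then have "t < t'" using Suc.prems(2) by simp
      obtain op where op: "op \<in> set (W ! t')" "a \<in> operation_qubits op" using True by blast
      moreover have "op \<noteq> Reset a" using Suc.prems(4) [of t'] Suc.prems(2) op(1) by auto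
      ultimately obtain h where "op = Unitary h" "a \<in> gate_qubits h"
        by (cases op rule: operation.exhaust) auto
      with op(1) have h: "Unitary h \<in> set (W ! t')" "a \<in> gate_qubits h" by auto
      \<comment> \<open>The gate in layer \<open>t\<close> ensures that the next wire down starts no
        lower than \<open>t\<close>, so it neither is an input wire nor leaves a reset.\<close>
      obtain s where s: "source W t' a = Some s" "t \<le> s"
        using source_ge [OF assms(4) _ \<open>t < t'\<close>, of a] assms(5) by auto
      with source_less [OF s(1)] Suc.prems(4)[of s] have "\<not> reset_output W (a, source W t' a)"
        by (auto simp: reset_output_def)
      then have "blue W Out (a, source W t' a)"
        using blue h Suc.prems(3) by (intro blue_down [of W Out a t' h]) auto
      with \<open>t < t'\<close> Suc show ?thesis by simp
    qed (use blue in simp)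
  next
    case False
    with assms(4,5) have "t \<noteq> t'" by force
    with False Suc show ?thesis by simp
  qed
qed simp

text \<open>Reset layers and empty layers are free: they add no layer to the lightcone, and only
  gates let it spread.\<close>

definition unitary_depth :: "'q process \<Rightarrow> nat" where
  "unitary_depth W = length (filter (\<lambda>L. unitaries L \<noteq> []) W)"

lemma unitary_depth_drop_Suc:
  assumes "t < length W"
  shows "unitary_depth (drop t W) =
    (if unitaries (W ! t) = [] then 0 else 1) + unitary_depth (drop (Suc t) W)"
  by (subst Cons_nth_drop_Suc [OF assms, symmetric]) (simp add: unitary_depth_def)

lemma unitary_depth_drop_mono:
  assumes "t \<le> t'"
  shows "unitary_depth (drop t' W) \<le> unitary_depth (drop t W)"
  using assms
proof (induction rule: dec_induct)
  case (step s)
  then show ?case using unitary_depth_drop_Suc [of s W]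
    by (cases "s < length W") (auto simp: unitary_depth_def)
qed simp

lemma nbhd_mono: "r \<le> s \<Longrightarrow> nbhd E A r \<subseteq> nbhd E A s"
  unfolding nbhd_def by (blast intro: order_trans)

lemma subset_nbhd: "A \<subseteq> nbhd E A r"
proof
  fix v assume "v \<in> A"
  moreover have "(v, v) \<in> E ^^ 0" by simp
  ultimately show "v \<in> nbhd E A r" unfolding nbhd_def by blast
qed

lemma nbhd_step: "u \<in> nbhd E A r \<Longrightarrow> (u, v) \<in> E \<Longrightarrow> v \<in> nbhd E A (Suc r)"
proof -
  assume "u \<in> nbhd E A r" and uv: "(u, v) \<in> E"
  then obtain w s where w: "w \<in> A" "s \<le> r" "(w, u) \<in> E ^^ s" by (auto simp: nbhd_def)
  from relpow_Suc_I [OF w(3) uv] have "(w, v) \<in> E ^^ Suc s" .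
  moreover have "Suc s \<le> Suc r" using w(2) by simp
  ultimately show ?thesis using w(1) unfolding nbhd_def by blast
qed

text \<open>In \<open>covered\<close> the same \<open>R\<close> bounds the number of unitary layers
  above the reset layer and gives the radius that is reset there. The lightcone of one output
  spreads by at most one lattice step per unitary layer, so it cannot get around that reset
  layer.\<close>

locale resetting_process =
  fixes W :: "'q process" and E :: "('q \<times> 'q) set" and Q :: "'q set" and R :: nat
  assumes layers: "L \<in> set W \<Longrightarrow>
      (\<exists>gs. L = map Unitary gs \<and> is_layer E gs) \<or> (\<exists>qs. L = map Reset qs)"
    and finite: "finite Q"
    and edges: "E \<subseteq> Q \<times> Q" "sym E"
    and covered: "v \<in> Q \<Longrightarrow> \<exists>r<length W. unitary_depth (drop (Suc r) W) \<le> R \<and>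
      (\<forall>u\<in>nbhd E {v} R. Reset u \<in> set (W ! r))"
begin

lemma unitary_layer:
  assumes "t < length W" "Unitary g \<in> set (W ! t)"
  obtains gs where "W ! t = map Unitary gs" "is_layer E gs" "g \<in> set gs"
  using layers [OF nth_mem [OF assms(1)]] assms(2) by auto

lemma gate_properties:
  assumes "t < length W" "Unitary g \<in> set (W ! t)"
  shows "proper_gate g" "gate_qubits g \<subseteq> Q"
    "a \<in> gate_qubits g \<Longrightarrow> b \<in> gate_qubits g \<Longrightarrow> a \<noteq> b \<Longrightarrow> (a, b) \<in> E"
proof -
  obtain gs where "is_layer E gs" "g \<in> set gs"
    using unitary_layer [OF assms] by metis
  moreover obtain a' b' M where g: "g = (a', b', M)" by (cases g)
  ultimately have e: "a' \<noteq> b'" "(a', b') \<in> E" "unitary_matrix M" by (auto simp: is_layer_def)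
  then show "proper_gate g" "gate_qubits g \<subseteq> Q"
    using edges(1) by (auto simp: g proper_gate_def)
  show "a \<in> gate_qubits g \<Longrightarrow> b \<in> gate_qubits g \<Longrightarrow> a \<noteq> b \<Longrightarrow> (a, b) \<in> E"
    using e(2) edges(2) by (auto simp: g sym_def)
qed

lemma not_reset_and_unitary:
  "t < length W \<Longrightarrow> Unitary g \<in> set (W ! t) \<Longrightarrow> Reset q \<notin> set (W ! t)"
  by (metis ex_map_conv operation.distinct(1) unitary_layer)

text \<open>The qubit \<open>u\<close>, right below layer \<open>t\<close>, is reached from the output \<open>v\<close>
  within as many steps as there are unitary layers above, and so lies in the region around
  \<open>v\<close> that is reset in the lower layer \<open>r\<close>.\<close>

definition confined :: "'q \<Rightarrow> nat \<Rightarrow> nat \<Rightarrow> 'q \<Rightarrow> bool" where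
  "confined v r t u \<longleftrightarrow> r < t \<and> t \<le> length W \<and>
    unitary_depth (drop (Suc r) W) \<le> R \<and> (\<forall>u\<in>nbhd E {v} R. Reset u \<in> set (W ! r)) \<and>
    u \<in> nbhd E {v} (unitary_depth (drop t W))"

lemma confined_reset:
  assumes "confined v r t u"
  shows "r < t" "Reset u \<in> set (W ! r)" "unitary_depth (drop (Suc r) W) \<le> R"
proof -
  show "r < t" and r: "unitary_depth (drop (Suc r) W) \<le> R"
    using assms by (simp_all add: confined_def)
  have "unitary_depth (drop t W) \<le> R"
    using unitary_depth_drop_mono [of "Suc r" t W] r \<open>r < t\<close> by simp
  then have "u \<in> nbhd E {v} R"
    using assms nbhd_mono [of "unitary_depth (drop t W)" R E "{v}"] by (auto simp: confined_def)
  then show "Reset u \<in> set (W ! r)" using assms by (simp add: confined_def)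
qed

text \<open>Crossing a gate moves at most one lattice step and uses up one counted layer, so the
  radius keeps pace. The gate lies above layer \<open>r\<close>: \<open>u\<close> is reset there, so
  its wire cannot start lower, and a reset layer contains no gates.\<close>

lemma confined_gate:
  assumes "confined v r t' u" "source W t' u = Some t"
    and "Unitary g \<in> set (W ! t)" "u \<in> gate_qubits g" "w \<in> gate_qubits g"
  shows "confined v r t w"
proof -
  note r = confined_reset [OF assms(1)]
  have "t < t'" using assms(2) by (rule source_less)
  then have t: "t < length W" using assms(1) by (simp add: confined_def)
  obtain s where "source W t' u = Some s" "r \<le> s"
    using source_ge [of "Reset u" W r u t'] r by auto
  then have "r \<le> t" using assms(2) by simp
  moreover have "r \<noteq> t"
    using not_reset_and_unitary [OF t assms(3)] r(2) by auto
  ultimately have "r < t" by simp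
  have "unitaries (W ! t) \<noteq> []"
    using assms(3) by (metis list.set(1) empty_iff set_unitaries)
  then have d: "unitary_depth (drop t W) = Suc (unitary_depth (drop (Suc t) W))"
    using unitary_depth_drop_Suc [OF t] by simp
  have u: "u \<in> nbhd E {v} (unitary_depth (drop (Suc t) W))"
    using assms(1) nbhd_mono [OF unitary_depth_drop_mono [of "Suc t" t' W], of E "{v}"] \<open>t < t'\<close>
    by (auto simp: confined_def)
  have "w \<in> nbhd E {v} (unitary_depth (drop t W))"
  proof (cases "u = w")
    case True
    with u d nbhd_mono show ?thesis by (metis le_SucI order_refl subsetD)
  next
    case False
    then have "(u, w) \<in> E" using gate_properties(3) [OF t assms(3,4,5)] by simp
    with u d nbhd_step show ?thesis by metis
  qed
  with assms(1) \<open>r < t\<close> t show ?thesis by (simp add: confined_def)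
qed

text \<open>A wire is tracked through some layer \<open>t\<close> below which it passes, since
  confinement counts what lies above \<open>t\<close>; its source becomes the next such
  layer.\<close>

lemma blue_confined:
  assumes "blue W Q w"
  shows "\<exists>v r t. snd w = source W t (fst w) \<and> confined v r t (fst w)"
  using assms
proof (induction rule: blue.induct)
  case (blue_out v)
  then obtain r where r: "r < length W" "unitary_depth (drop (Suc r) W) \<le> R"
      "\<forall>u\<in>nbhd E {v} R. Reset u \<in> set (W ! r)"
    using covered by blast
  with subset_nbhd [of "{v}" E] have "confined v r (length W) v" by (simp add: confined_def)
  then show ?case by auto
next
  case (blue_down u t g w)
  then obtain v r t' where "Some t = source W t' u" "confined v r t' u" by auto
  with blue_down.hyps confined_gate [of v r t' u t g w] show ?case by auto
qed

lemma not_reaches_input: "\<not> reaches_input W Q"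
proof
  assume "reaches_input W Q"
  then obtain u where "blue W Q (u, None)" by (auto simp: reaches_input_def)
  from blue_confined [OF this] obtain v r t where *: "source W t u = None" "confined v r t u"
    by (metis fst_conv snd_conv)
  from confined_reset [OF *(2)] source_ge [of "Reset u" W r u t] *(1) show False by auto
qed

section \<open>Green gates along lines\<close>

lemma green_confined:
  assumes "green W Q t g"
  obtains v r where "\<And>a. a \<in> gate_qubits g \<Longrightarrow> confined v r t a"
proof -
  obtain u where t: "Unitary g \<in> set (W ! t)" and u: "u \<in> gate_qubits g" "blue W Q (u, Some t)"
    using assms by (auto simp: green_def)
  obtain v r t' where "Some t = source W t' u" "confined v r t' u"
    using blue_confined [OF u(2)] by auto
  with t u(1) have "confined v r t a" if "a \<in> gate_qubits g" for a
    using confined_gate that by metis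
  then show ?thesis by (rule that)
qed

lemma green_gate_line_start:
  assumes "green W Q t g" "a \<in> gate_qubits g"
  shows "line_start W t a \<noteq> None"
proof -
  obtain v r where "confined v r t a" using green_confined assms by metis
  from confined_reset [OF this] line_start_ge [of a W r t] show ?thesis by auto
qed

lemma output_line_start:
  assumes "a \<in> Q"
  shows "line_start W (length W) a \<noteq> None"
proof -
  obtain r where "r < length W" "\<forall>u\<in>nbhd E {a} R. Reset u \<in> set (W ! r)"
    using covered [OF assms] by blast
  moreover have "a \<in> nbhd E {a} R" using subset_nbhd [of "{a}" E R] by simp
  ultimately show ?thesis using line_start_ge [of a W r "length W"] by auto
qed

text \<open>No reset separates the gate from the output, so blue descends to it from the output
  wire. Contraposed: gates outside the lightcone never touch an output line.\<close>

lemma green_output: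
  assumes "t < length W" "Unitary g \<in> set (W ! t)" "a \<in> gate_qubits g" "a \<in> Q"
    and "line_start W t a = line_start W (length W) a"
  shows "green W Q t g"
proof -
  have "blue W Q (a, Some t)"
    using blue_propagates_down [of W Q a "length W" t g] blue_out [of a Q W] assms
      line_start_eq_imp_no_reset [of W t a "length W"] by auto
  with assms show ?thesis by (auto simp: green_def)
qed

text \<open>The later gate colours its input wire of \<open>a\<close> blue, since on a shared line
  with a gate below that wire does not leave a reset; blue then descends to the earlier gate.
  Contraposed: a gate outside the lightcone shares no line with a later green gate, so it can be
  moved past it.\<close>

lemma green_below_green:
  assumes "t < t'" "Unitary g \<in> set (W ! t)" "green W Q t' g'"
    and a: "a \<in> gate_qubits g" "a \<in> gate_qubits g'"
    and line: "line_start W t a = line_start W t' a"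
  shows "green W Q t g"
proof -
  obtain u where t': "t' < length W" "Unitary g' \<in> set (W ! t')" "u \<in> gate_qubits g'"
      "blue W Q (u, Some t')"
    using assms(3) by (auto simp: green_def)
  note nr = line_start_eq_imp_no_reset [OF line]
  obtain s where s: "source W t' a = Some s" "t \<le> s"
    using source_ge [OF assms(2) _ \<open>t < t'\<close>, of a] a(1) by auto
  with source_less [OF s(1)] nr [of s] have "\<not> reset_output W (a, source W t' a)"
    by (auto simp: reset_output_def)
  then have "blue W Q (a, source W t' a)"
    using t' a(2) by (intro blue_down [of W Q u t' g']) auto
  then have "blue W Q (a, Some t)"
    using blue_propagates_down [of W Q a t' t g] assms(1,2) t'(1) a(1) nr by auto
  with assms(1,2) t'(1) a(1) show ?thesis by (auto simp: green_def)
qed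

section \<open>From the process to a unitary circuit on lines\<close>

lemma sorted_timed_gates:
  assumes "T \<le> length W"
  shows "sorted_wrt (\<lambda>(t, g) (t', g'). t < t' \<or> t = t' \<and> gate_qubits g \<inter> gate_qubits g' = {})
    (timed_gates W T)"
  using assms
proof (induction T)
  case (Suc T)
  have "sorted_wrt (\<lambda>g g'. gate_qubits g \<inter> gate_qubits g' = {}) (unitaries (W ! T))"
    using layers [OF nth_mem [of T W]] Suc.prems by (auto simp: is_layer_def)
  then show ?case
    using Suc by (auto simp: sorted_wrt_append sorted_wrt_map set_timed_gates)
qed simp

lemma sorted_green:
  "sorted_wrt (\<lambda>e e'. \<not> (case e of (t, g) \<Rightarrow> green W Q t g) \<longrightarrow> (case e' of (t, g) \<Rightarrow> green W Q t g) \<longrightarrow>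
      gate_qubits (lift_gate W e) \<inter> gate_qubits (lift_gate W e') = {})
    (timed_gates W (length W))"
proof (rule sorted_wrt_mono_rel [OF _ sorted_timed_gates [OF order_refl]])
  fix e e'
  assume e: "e \<in> set (timed_gates W (length W))"
    and order: "(\<lambda>(t, g) (t', g'). t < t' \<or> t = t' \<and> gate_qubits g \<inter> gate_qubits g' = {}) e e'"
  obtain t g t' g' where [simp]: "e = (t, g)" "e' = (t', g')" by (cases e, cases e')
  have "gate_qubits (lift_gate W (t, g)) \<inter> gate_qubits (lift_gate W (t', g')) = {}"
    if "\<not> green W Q t g" "green W Q t' g'"
  proof (cases "t = t'")
    case True
    with order show ?thesis by (auto simp: gate_qubits_lift_gate)
  next
    case False
    with order e have "t < t'" "Unitary g \<in> set (W ! t)" by (auto simp: set_timed_gates)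
    with that green_below_green [of t t' g g'] show ?thesis by (auto simp: gate_qubits_lift_gate)
  qed
  then show "\<not> (case e of (t, g) \<Rightarrow> green W Q t g) \<longrightarrow> (case e' of (t, g) \<Rightarrow> green W Q t g) \<longrightarrow>
      gate_qubits (lift_gate W e) \<inter> gate_qubits (lift_gate W e') = {}"
    by (simp del: gate_qubits.simps)
qed

text \<open>The invariant places the current state on the current lines. A unitary layer changes no
  line, and a reset layer changes only lines of qubits in the zero state, which relabelling does not
  notice.\<close>

lemma apply_timed_gates:
  assumes "resets_trivial (concat W) \<psi>" "T \<le> length W"
  shows "apply_gates (map (lift_gate W) (timed_gates W T)) (relabel (\<lambda>v. (v, None)) Q \<psi>) =
    relabel (\<lambda>v. (v, line_start W T v)) Q (fold skip_reset (concat (take T W)) \<psi>)"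
  using assms(2)
proof (induction T)
  case (Suc T)
  then have T: "T < length W" by simp
  define \<phi> where "\<phi> = fold skip_reset (concat (take T W)) \<psi>"
  have W: "concat W = concat (take T W) @ (W ! T) @ concat (drop (Suc T) W)"
    by (metis T append_take_drop_id Cons_nth_drop_Suc concat.simps(2) concat_append)
  have IH: "apply_gates (map (lift_gate W) (timed_gates W (Suc T))) (relabel (\<lambda>v. (v, None)) Q \<psi>) =
      apply_gates (map (lift_gate W \<circ> Pair T) (unitaries (W ! T)))
        (relabel (\<lambda>v. (v, line_start W T v)) Q \<phi>)"
    using Suc by (simp add: \<phi>_def)
  have step: "fold skip_reset (concat (take (Suc T) W)) \<psi> = fold skip_reset (W ! T) \<phi>"
    using T by (simp add: take_Suc_conv_app_nth \<phi>_def)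
  have inj: "inj_on (\<lambda>v. (v, f v)) Q" for f :: "'q \<Rightarrow> nat option"
    by (auto simp: inj_on_def)
  from layers [OF nth_mem [OF T]] show ?case
  proof (elim disjE exE conjE)
    fix gs assume gs: "W ! T = map Unitary gs"
    have "lift_gate W \<circ> Pair T = (\<lambda>(a, b, M). ((a, line_start W T a), (b, line_start W T b), M))"
      by auto
    moreover have "(\<lambda>v. (v, line_start W (Suc T) v)) = (\<lambda>v. (v, line_start W T v))"
      using gs by auto
    moreover have "gate_qubits g \<subseteq> Q" if "g \<in> set gs" for g
      using gate_properties(2) [OF T] gs that by auto
    ultimately show ?thesis
      unfolding IH step using gs by (simp add: apply_gates_relabel [OF inj])
  next
    fix qs assume qs: "W ! T = map Reset qs"
    have "resets_trivial (W ! T) \<phi>"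
      using assms(1) by (simp add: W resets_trivial_append \<phi>_def)
    then have "zero_on q \<phi>" if "q \<in> set qs" for q using qs that by simp
    then have "relabel (\<lambda>v. (v, line_start W T v)) Q \<phi> = relabel (\<lambda>v. (v, line_start W (Suc T) v)) Q \<phi>"
      by (intro relabel_cong_zero_on inj) (auto simp: qs split: if_splits)
    then show ?thesis unfolding IH step using qs by simp
  qed
qed simp

section \<open>Qubits, depth and ancilla count of the lightcone\<close>

lemma circuit_qubits_lightcone:
  assumes "p \<in> circuit_qubits (lightcone W Q)"
  obtains v r where "p = (v, Some r)" "v \<in> Q" "r < length W" "Reset v \<in> set (W ! r)"
proof -
  obtain t g where g: "(t, g) \<in> set (timed_gates W (length W))" "green W Q t g"
      "p \<in> gate_qubits (lift_gate W (t, g))"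
    using assms unfolding circuit_qubits_def concat_lightcone by auto
  then obtain v where v: "v \<in> gate_qubits g" "p = (v, line_start W t v)"
    by (auto simp: gate_qubits_lift_gate)
  obtain r where r: "line_start W t v = Some r"
    using green_gate_line_start [OF g(2) v(1)] by auto
  have t: "t < length W" "Unitary g \<in> set (W ! t)" using g(1) by (simp_all add: set_timed_gates)
  show ?thesis
    using that [of v r] v r line_start_less [OF r] line_start_reset [OF r] t gate_properties(2) [OF t]
    by auto
qed

text \<open>Different outputs may be stopped by different reset layers, but the lowest green layer
  alone decides: it lies above some reset layer that has at most \<open>R\<close> unitary layers
  over it, and all green gates lie at or above it.\<close>

lemma length_lightcone: "length (lightcone W Q) \<le> R"
proof (cases "\<exists>t g. green W Q t g")
  case False
  then have "lightcone W Q = []" by (auto simp: lightcone_eq filter_empty_conv)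
  then show ?thesis by simp
next
  case True
  define T where "T = (LEAST t. \<exists>g. green W Q t g)"
  define f where "f = (\<lambda>t. filter (green W Q t) (unitaries (W ! t)))"
  obtain g where g: "green W Q T g" unfolding T_def using LeastI_ex [OF True] by auto
  have "T < length W" using g by (simp add: green_def)
  have below: "f t = []" if "t < T" for t
    using not_less_Least [of t "\<lambda>t. \<exists>g. green W Q t g"] that
    by (auto simp: T_def f_def filter_empty_conv)
  have "length (lightcone W Q) = length (filter (\<lambda>t. f t \<noteq> []) [0..<length W])"
    by (simp add: lightcone_eq filter_map o_def f_def)
  also have "[0..<length W] = [0..<T] @ [T..<length W]"
    using \<open>T < length W\<close> by (metis upt_add_eq_append less_imp_le le_add_diff_inverse zero_le)
  also have "length (filter (\<lambda>t. f t \<noteq> []) ([0..<T] @ [T..<length W])) =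
      length (filter (\<lambda>t. f t \<noteq> []) [T..<length W])"
    using below by (simp add: filter_empty_conv)
  also have "\<dots> \<le> length (filter (\<lambda>t. unitaries (W ! t) \<noteq> []) [T..<length W])"
  proof -
    have "filter (\<lambda>t. f t \<noteq> []) [T..<length W] =
        filter (\<lambda>t. f t \<noteq> []) (filter (\<lambda>t. unitaries (W ! t) \<noteq> []) [T..<length W])"
      by (auto simp: f_def intro!: filter_cong)
    then show ?thesis by (metis length_filter_le)
  qed
  also have "\<dots> = unitary_depth (drop T W)"
  proof -
    have "drop T W = map ((!) W) [T..<length W]"
      by (metis drop_map drop_upt add_0 map_nth)
    then show ?thesis by (simp add: unitary_depth_def filter_map o_def)
  qed
  also have "\<dots> \<le> R"
  proof -
    obtain a where "a \<in> gate_qubits g" by (cases g) auto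
    then obtain v r where "confined v r T a" using green_confined [OF g] by metis
    from confined_reset [OF this] unitary_depth_drop_mono [of "Suc r" T W]
    show ?thesis by simp
  qed
  finally show ?thesis .
qed

lemma is_circuit_lightcone: "is_circuit (line_edges E) R (lightcone W Q)"
  unfolding is_circuit_def
proof (intro conjI ballI length_lightcone)
  fix L assume "L \<in> set (lightcone W Q)"
  then obtain t where t: "t < length W"
    and L: "L = map (lift_gate W \<circ> Pair t) (filter (green W Q t) (unitaries (W ! t)))"
    by (fastforce simp: lightcone_eq)
  have layer: "is_layer E (unitaries (W ! t))"
    using layers [OF nth_mem [OF t]] by (auto simp: is_layer_def)
  have "sorted_wrt (\<lambda>g h. gate_qubits g \<inter> gate_qubits h = {})
      (filter (green W Q t) (unitaries (W ! t)))"
    using layer by (auto simp: is_layer_def intro: sorted_wrt_filter)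
  then have "sorted_wrt (\<lambda>g h. gate_qubits g \<inter> gate_qubits h = {}) L"
    unfolding L sorted_wrt_map
    by (rule sorted_wrt_mono_rel [rotated]) (auto simp: gate_qubits_lift_gate)
  moreover have "\<forall>(a, b, M)\<in>set L. a \<noteq> b \<and> (a, b) \<in> line_edges E \<and> unitary_matrix M"
    using layer by (fastforce simp: L is_layer_def line_edges_def)
  ultimately show "is_layer (line_edges E) L" by (simp add: is_layer_def)
qed

lemma ancillas_subset:
  "ancillas W Q \<subseteq> Q \<times> Some ` {r. r < length W \<and> (\<exists>v. Reset v \<in> set (W ! r))}"
  by (auto simp: ancillas_def elim!: circuit_qubits_lightcone)

lemma finite_ancillas: "finite (ancillas W Q)"
  using finite_subset [OF ancillas_subset] finite by simp

lemma card_ancillas: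
  "card (ancillas W Q) \<le> card Q * card {r. r < length W \<and> (\<exists>v. Reset v \<in> set (W ! r))}"
proof -
  have "card (ancillas W Q) \<le> card (Q \<times> Some ` {r. r < length W \<and> (\<exists>v. Reset v \<in> set (W ! r))})"
    using ancillas_subset finite by (intro card_mono) auto
  then show ?thesis by (simp add: card_cartesian_product card_image)
qed

lemma lines_not_input:
  assumes "p \<in> output_line W ` Q \<union> ancillas W Q"
  shows "snd p \<noteq> None"
  using assms output_line_start by (auto simp: output_line_def ancillas_def elim!: circuit_qubits_lightcone)

text \<open>To discard the input lines, they are projected onto a basis state \<open>x0\<close> with
  \<open>\<psi> x0 \<noteq> 0\<close>.\<close>

lemma lightcone_prepares:
  assumes state: "is_state Q \<psi>"
    and trivial: "resets_trivial (concat W) \<psi>" "fold skip_reset (concat W) \<psi> = \<psi>"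
  defines "sys \<equiv> output_line W ` Q" and "anc \<equiv> ancillas W Q"
  shows "\<exists>junk. is_state anc junk \<and> run (lightcone W Q) (tensor sys anc zero_state zero_state) =
    tensor sys anc (relabel (output_line W) Q \<psi>) junk"
proof -
  let ?green = "\<lambda>(t, g). green W Q t g"
  define es where "es = timed_gates W (length W)"
  define C where "C = map (lift_gate W) (filter ?green es)"
  define N where "N = map (lift_gate W) (filter (\<lambda>e. \<not> ?green e) es)"
  define N' where "N' = rev (map dagger_gate N)"
  define inp where "inp = (\<lambda>v :: 'q. (v, None :: nat option))"
  define out where "out = output_line W"
  \<comment> \<open>\<open>G B\<close> is the unnormalised sum of all basis states of
    \<open>B\<close>, with zeros elsewhere. It is what is left of a relabelled state once the
    amplitude of \<open>\<psi>\<close> is split off as a factor.\<close>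
  define G :: "('q \<times> nat option) set \<Rightarrow> ('q \<times> nat option) qvec"
    where "G = (\<lambda>B x. if x \<in> basis B then 1 else 0)"
  define pull :: "('q \<Rightarrow> 'q \<times> nat option) \<Rightarrow> ('q \<times> nat option \<Rightarrow> bool) \<Rightarrow> 'q \<Rightarrow> bool"
    where "pull = (\<lambda>f x q. q \<in> Q \<and> x (f q))"
  have es: "t < length W \<and> Unitary g \<in> set (W ! t)" if "(t, g) \<in> set es" for t g
    using that by (simp add: es_def set_timed_gates)
  have out: "out = (\<lambda>v. (v, line_start W (length W) v))"
    by (auto simp: out_def output_line_def)
  have C_inp: "gate_qubits h \<inter> inp ` Q = {}" if h_in: "h \<in> set C" for h
  proof -
    obtain t g where h: "h = lift_gate W (t, g)" "green W Q t g"
      using h_in by (auto simp: C_def)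
    with green_gate_line_start show ?thesis by (fastforce simp: gate_qubits_lift_gate inp_def)
  qed
  have N_out: "gate_qubits h \<inter> out ` Q = {}" if h_in: "h \<in> set N'" for h
  proof -
    obtain t g where h: "h = dagger_gate (lift_gate W (t, g))" "(t, g) \<in> set es" "\<not> green W Q t g"
      using h_in by (auto simp: N'_def N_def simp del: dagger_gate.simps lift_gate.simps)
    with green_output [of t g] es [of t g] show ?thesis
      by (auto simp: gate_qubits_lift_gate out)
  qed
  have proper: "proper_gate (lift_gate W e)" if "e \<in> set es" for e
  proof -
    obtain t g where "e = (t, g)" by (cases e)
    then show ?thesis using that es [of t g] gate_properties(1) proper_gate_lift_gate by metis
  qed
  have relabel_eq: "relabel f Q \<psi> = (\<lambda>x. \<psi> (pull f x) * G (f ` Q) x)" for f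
    by (auto simp: relabel_def pull_def G_def)
  have c_dep: "depends_off (- (f ` Q)) (\<lambda>x. \<psi> (pull f x))" for f
  proof -
    have "pull f x = pull f y" if "\<forall>p\<in>f ` Q. x p = y p" for x y
      using that by (auto simp: pull_def)
    then show ?thesis unfolding depends_off_def by (metis ComplD)
  qed
  have G_dep: "depends_off B (G B)" for B
    by (auto simp: depends_off_def G_def basis_def)

  have "apply_gates N (apply_gates C (relabel inp Q \<psi>)) = apply_gates (map (lift_gate W) es) (relabel inp Q \<psi>)"
    using apply_gates_partition [OF sorted_green, of "relabel inp Q \<psi>"]
    by (simp add: N_def C_def es_def)
  also have "\<dots> = relabel out Q \<psi>"
    using apply_timed_gates [OF trivial(1) order_refl] trivial(2) by (simp add: es_def inp_def out)
  finally have "apply_gates N (apply_gates C (relabel inp Q \<psi>)) = relabel out Q \<psi>" .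
  moreover have "proper_gate h" if "h \<in> set N" for h
    using that proper by (auto simp: N_def simp del: lift_gate.simps)
  ultimately have "apply_gates C (relabel inp Q \<psi>) = apply_gates N' (relabel out Q \<psi>)"
    unfolding N'_def by (metis apply_gates_inverse)
  \<comment> \<open>\<open>C\<close> cannot change the input bits and \<open>N'\<close> cannot
    change the output bits, so the amplitude of \<open>\<psi>\<close> leaves both circuits.\<close>
  then have "(\<lambda>x. \<psi> (pull inp x) * apply_gates C (G (inp ` Q)) x) =
      (\<lambda>x. \<psi> (pull out x) * apply_gates N' (G (out ` Q)) x)"
    by (simp only: relabel_eq apply_gates_mult [OF c_dep C_inp] apply_gates_mult [OF c_dep N_out])
  then have eq: "\<psi> (pull inp x) * apply_gates C (G (inp ` Q)) x =
      \<psi> (pull out x) * apply_gates N' (G (out ` Q)) x" for x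
    by (rule fun_cong)

  obtain x0 where x0: "x0 \<in> basis Q" "\<psi> x0 \<noteq> 0"
  proof -
    have "\<not> (\<forall>x\<in>basis Q. \<psi> x = 0)"
    proof
      assume "\<forall>x\<in>basis Q. \<psi> x = 0"
      then have "(\<Sum>x\<in>basis Q. (cmod (\<psi> x))\<^sup>2) = 0" by simp
      with state show False by (simp add: is_state_def)
    qed
    then show ?thesis using that by blast
  qed
  \<comment> \<open>Writing \<open>x0\<close> on the input lines turns the left factor of
    \<open>eq\<close> into the nonzero number \<open>\<psi> x0\<close>, which can be divided
    out.\<close>
  define ext where "ext = (\<lambda>y p. if p \<in> inp ` Q then x0 (fst p) else y p)"
  \<comment> \<open>A basis state of \<open>anc\<close> reads zero on the output lines. This loses
    nothing, because the result of \<open>N'\<close> on \<open>G\<close> does not depend on the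
    output bits.\<close>
  define junk where "junk = (\<lambda>w. if w \<in> basis anc
    then apply_gates N' (G (out ` Q)) (ext w) / \<psi> x0 else 0)"
  have disj: "inp ` Q \<inter> (sys \<union> anc) = {}"
  proof -
    have "(v, None) \<notin> sys \<union> anc" for v
      using lines_not_input [of "(v, None)"] by (auto simp: sys_def anc_def)
    then show ?thesis by (auto simp: inp_def)
  qed
  have sys_anc: "sys \<inter> anc = {}" by (auto simp: sys_def anc_def ancillas_def)
  have fin: "finite (sys \<union> anc)" using finite finite_ancillas by (simp add: sys_def anc_def)

  have C_eq: "concat (lightcone W Q) = C" by (simp add: C_def es_def concat_lightcone)
  have C_lines: "gate_qubits h \<subseteq> sys \<union> anc" if "h \<in> set C" for h
  proof -
    have "gate_qubits h \<subseteq> circuit_qubits (lightcone W Q)"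
      using that by (intro gate_qubits_subset_circuit_qubits) (simp add: C_eq)
    then show ?thesis by (auto simp: sys_def anc_def ancillas_def)
  qed
  have "is_state (sys \<union> anc) (apply_gates C zero_state)"
    using C_lines proper by (intro is_state_apply_gates is_state_zero_state fin) (auto simp: C_def)
  note F = this

  have prepared: "apply_gates C zero_state x = \<psi> (pull out x) * (apply_gates N' (G (out ` Q)) (ext x) / \<psi> x0)"
    if x: "x \<in> basis (sys \<union> anc)" for x
  proof -
    let ?off = "\<lambda>x. if \<forall>p\<in>inp ` Q. \<not> x p then 1 else (0 :: complex)"
    have off: "\<not> x p" if "p \<in> inp ` Q" for p
      using x disj that by (auto simp: basis_def)
    \<comment> \<open>The zero state is \<open>G\<close> of the input lines, cut down to zero input
      bits. \<open>C\<close> ignores those bits, so the cut commutes with it and the input bits may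
      then be replaced by \<open>x0\<close>.\<close>
    have zero_eq: "zero_state = (\<lambda>x. ?off x * G (inp ` Q) x)"
      by (auto simp: zero_state_def G_def basis_def fun_eq_iff) (metis surj_pair)
    have off_dep: "depends_off (- (inp ` Q)) ?off"
      unfolding depends_off_def by (metis ComplD)
    have "apply_gates C zero_state = (\<lambda>x. ?off x * apply_gates C (G (inp ` Q)) x)"
      by (subst zero_eq, rule apply_gates_mult [OF off_dep C_inp])
    then have "apply_gates C zero_state x = ?off x * apply_gates C (G (inp ` Q)) x"
      by (rule fun_cong)
    also have "\<dots> = apply_gates C (G (inp ` Q)) (ext x)"
      using depends_off_apply_gates [OF G_dep C_inp] off
      by (auto simp: depends_off_def ext_def)
    also have "\<dots> = \<psi> (pull inp (ext x)) * apply_gates C (G (inp ` Q)) (ext x) / \<psi> x0"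
    proof -
      have "pull inp (ext x) = x0"
        using x0(1) by (auto simp: pull_def ext_def inp_def basis_def)
      then show ?thesis using x0(2) by simp
    qed
    also have "\<dots> = \<psi> (pull out (ext x)) * apply_gates N' (G (out ` Q)) (ext x) / \<psi> x0"
      by (simp only: eq)
    also have "pull out (ext x) = pull out x"
      using disj by (auto simp: pull_def ext_def sys_def out_def fun_eq_iff)
    finally show ?thesis by simp
  qed

  have tensor: "apply_gates C zero_state = tensor sys anc (relabel out Q \<psi>) junk"
  proof
    fix x
    show "apply_gates C zero_state x = tensor sys anc (relabel out Q \<psi>) junk x"
    proof (cases "x \<in> basis (sys \<union> anc)")
      case False
      with F show ?thesis by (simp add: tensor_def is_state_def)
    next
      case True
      have "relabel out Q \<psi> (\<lambda>p. p \<in> sys \<and> x p) = \<psi> (pull out x)"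
      proof -
        have "(\<lambda>q. q \<in> Q \<and> out q \<in> sys \<and> x (out q)) = pull out x"
          by (auto simp: pull_def sys_def out_def)
        then show ?thesis by (auto simp: relabel_def basis_def sys_def out_def)
      qed
      moreover have "junk (\<lambda>p. p \<in> anc \<and> x p) = apply_gates N' (G (out ` Q)) (ext x) / \<psi> x0"
      proof -
        have "ext (\<lambda>p. p \<in> anc \<and> x p) p = ext x p" if "p \<notin> out ` Q" for p
          using that True by (auto simp: ext_def basis_def sys_def out_def)
        then have "apply_gates N' (G (out ` Q)) (ext (\<lambda>p. p \<in> anc \<and> x p)) =
            apply_gates N' (G (out ` Q)) (ext x)"
          using depends_off_apply_gates [OF G_dep N_out] unfolding depends_off_def by blast
        then show ?thesis by (simp add: junk_def basis_def)
      qed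
      ultimately show ?thesis using prepared [OF True] True by (simp add: tensor_def)
    qed
  qed

  have "inj_on out Q" by (auto simp: out inj_on_def)
  \<comment> \<open>The norm of the junk state is not computed directly: the product and its system
    factor both have norm one, which forces it.\<close>
  have "1 = (\<Sum>x\<in>basis (sys \<union> anc). (cmod (apply_gates C zero_state x))\<^sup>2)"
    using F by (simp add: is_state_def)
  also have "\<dots> = (\<Sum>x\<in>basis sys. (cmod (relabel out Q \<psi> x))\<^sup>2) * (\<Sum>x\<in>basis anc. (cmod (junk x))\<^sup>2)"
    unfolding tensor by (rule norm_tensor [OF sys_anc])
  also have "(\<Sum>x\<in>basis sys. (cmod (relabel out Q \<psi> x))\<^sup>2) = 1"
    using norm_relabel [OF \<open>inj_on out Q\<close>, of \<psi>] state by (simp add: sys_def out_def is_state_def)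
  finally have "is_state anc junk" by (simp add: is_state_def junk_def)
  moreover have "tensor sys anc zero_state zero_state = zero_state"
    by (auto simp: tensor_def zero_state_def basis_def fun_eq_iff)
  ultimately show ?thesis
    using tensor by (auto simp: run_def C_eq out_def)
qed

end

section \<open>The reconstruction process\<close>

lemma lattice_edges:
  assumes "is_lattice k n E"
  shows "E \<subseteq> {1..n} \<times> {1..n}" "sym E"
proof -
  obtain pos where E: "E = {(u, v). u \<in> {1..n} \<and> v \<in> {1..n} \<and> grid_adjacent (pos u) (pos v)}"
    using assms unfolding is_lattice_def by blast
  then show "E \<subseteq> {1..n} \<times> {1..n}" by auto
  have "grid_adjacent x y \<Longrightarrow> grid_adjacent y x" for x y
    unfolding grid_adjacent_def by metis
  then show "sym E" by (auto simp: E sym_def)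
qed

lemma zero_on_local_inversion:
  assumes "local_inversion Q A U \<psi>" "q \<in> A"
  shows "zero_on q (apply_gates (concat U) \<psi>)"
  using assms by (auto simp: local_inversion_def run_def zero_on_def tensor_def zero_state_def fun_eq_iff)

lemma length_filter_concat_le:
  assumes "\<And>xs. xs \<in> set xss \<Longrightarrow> length (filter P xs) \<le> b"
  shows "length (filter P (concat xss)) \<le> length xss * b"
  using assms by (induction xss) (auto simp: add_mono)

lemma unitary_depth_append: "unitary_depth (xs @ ys) = unitary_depth xs + unitary_depth ys"
  by (simp add: unitary_depth_def)

lemma unitary_depth_le_length: "unitary_depth xs \<le> length xs"
  by (simp add: unitary_depth_def)

lemma concat_map_map: "concat (map (map f) xss) = map f (concat xss)"
  by (simp add: map_concat)

locale reconstruction =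
  fixes n :: nat and E :: "(nat \<times> nat) set" and l c d :: nat and m :: "nat \<Rightarrow> nat"
    and S :: "nat \<Rightarrow> nat \<Rightarrow> nat set" and V :: "nat \<Rightarrow> nat \<Rightarrow> nat circuit" and \<psi> :: "nat qvec"
  assumes edges: "E \<subseteq> {1..n} \<times> {1..n}" "sym E"
    and scheme: "covering_scheme n E l c d m S"
    and inversion: "i \<in> {1..l} \<Longrightarrow> j \<in> {1..m i} \<Longrightarrow> is_circuit E d (V i j) \<and>
      circuit_qubits (V i j) \<subseteq> nbhd E (S i j) d \<and> local_inversion {1..n} (S i j) (V i j) \<psi>"
begin

definition inversions :: "nat \<Rightarrow> nat circuit list" where
  "inversions i = map (V i) [1..<Suc (m i)]"

definition resets :: "nat \<Rightarrow> nat list" where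
  "resets i = concat (map (\<lambda>j. sorted_list_of_set (S i j)) [1..<Suc (m i)])"

lemma stage_eq:
  "reconstruction_stage m S V i = map (map Unitary) (parallel (inversions i)) @
    [map Reset (resets i)] @ map (map Unitary) (parallel (map dagger_circuit (inversions i)))"
  by (simp add: reconstruction_stage_def inversions_def resets_def map_concat o_def)

lemma inversions_disjoint:
  assumes "i \<in> {1..l}"
  shows "sorted_wrt (\<lambda>C C'. circuit_qubits C \<inter> circuit_qubits C' = {}) (inversions i)"
  unfolding inversions_def sorted_wrt_map
proof (rule sorted_wrt_mono_rel [OF _ sorted_wrt_upt])
  fix j j' assume "j \<in> set [1..<Suc (m i)]" "j' \<in> set [1..<Suc (m i)]" "j < j'"
  then have j: "j \<in> {1..m i}" "j' \<in> {1..m i}" "j \<noteq> j'" by auto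
  with scheme assms have "nbhd E (S i j) d \<inter> nbhd E (S i j') d = {}"
    unfolding covering_scheme_def by blast
  with inversion [OF assms j(1)] inversion [OF assms j(2)]
  show "circuit_qubits (V i j) \<inter> circuit_qubits (V i j') = {}" by blast
qed

lemma dagger_inversions_disjoint:
  assumes "i \<in> {1..l}"
  shows "sorted_wrt (\<lambda>C C'. circuit_qubits C \<inter> circuit_qubits C' = {})
    (map dagger_circuit (inversions i))"
  using inversions_disjoint [OF assms] by (simp add: sorted_wrt_map)

lemma is_circuit_inversions:
  assumes "i \<in> {1..l}"
  shows "is_circuit E d (parallel (inversions i))"
    and "is_circuit E d (parallel (map dagger_circuit (inversions i)))"
proof -
  have "is_circuit E d C" if "C \<in> set (inversions i)" for C
    using that inversion [OF assms]
    by (auto simp: inversions_def atLeastLessThanSuc_atLeastAtMost simp del: upt_Suc)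
  then show "is_circuit E d (parallel (inversions i))"
      "is_circuit E d (parallel (map dagger_circuit (inversions i)))"
    by (auto intro!: is_circuit_parallel is_circuit_dagger_circuit
        inversions_disjoint dagger_inversions_disjoint assms)
qed

lemma reset_if_covered:
  assumes "i \<in> {1..l}" "j \<in> {1..m i}" "q \<in> S i j"
  shows "q \<in> set (resets i)"
proof -
  have "S i j \<subseteq> {1..n}" using scheme assms unfolding covering_scheme_def by blast
  then have "finite (S i j)" by (rule finite_subset) simp
  with assms show ?thesis by (auto simp: resets_def simp del: upt_Suc intro!: bexI [of _ j])
qed

text \<open>The inversion \<open>V i j\<close> is specified for \<open>\<psi>\<close> itself, but it
  runs alongside the other inversions of its stage. Those act on disjoint neighbourhoods, so they
  can be moved after \<open>V i j\<close>, where they do not touch \<open>q\<close>.\<close>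

lemma zero_on_inverted:
  assumes i: "i \<in> {1..l}" and q: "q \<in> set (resets i)"
  shows "zero_on q (apply_gates (concat (parallel (inversions i))) \<psi>)"
proof -
  obtain j where j: "j \<in> {1..m i}" "q \<in> set (sorted_list_of_set (S i j))"
    using q by (auto simp: resets_def atLeastLessThanSuc_atLeastAtMost simp del: upt_Suc)
  then have qj: "q \<in> S i j" by (cases "finite (S i j)") auto
  have "[1..<Suc (m i)] = [1..<j] @ [j..<Suc (m i)]"
    using j(1) upt_add_eq_append [of 1 j "Suc (m i) - j"] by simp
  also have "[j..<Suc (m i)] = j # [Suc j..<Suc (m i)]"
    using j(1) by (intro upt_conv_Cons) simp
  finally have split: "[1..<Suc (m i)] = [1..<j] @ j # [Suc j..<Suc (m i)]" .
  define pre where "pre = concat (map concat (map (V i) [1..<j]))"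
  define post where "post = concat (map concat (map (V i) [Suc j..<Suc (m i)]))"
  have gates: "\<exists>j'\<in>{1..m i}. j' \<noteq> j \<and> gate_qubits g \<subseteq> nbhd E (S i j') d"
    if g: "g \<in> set (pre @ post)" for g
  proof -
    have "g \<in> (\<Union>j'\<in>{1..<j} \<union> {Suc j..<Suc (m i)}. set (concat (V i j')))"
      using g by (auto simp: pre_def post_def simp del: upt_Suc)
    then obtain j' where "j' \<in> {1..<j} \<union> {Suc j..<Suc (m i)}" "g \<in> set (concat (V i j'))"
      by blast
    with j(1) have j': "j' \<in> {1..m i}" "j' \<noteq> j" "g \<in> set (concat (V i j'))" by auto
    then show ?thesis
      using gate_qubits_subset_circuit_qubits [of g "V i j'"] inversion [OF i j'(1)] by blast
  qed
  have disj: "gate_qubits g \<inter> nbhd E (S i j) d = {}" if "g \<in> set (pre @ post)" for g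
    using gates [OF that] scheme i j(1) unfolding covering_scheme_def by blast
  have "apply_gates (concat (parallel (inversions i))) \<psi> =
      apply_gates post (apply_gates (concat (V i j)) (apply_gates pre \<psi>))"
    unfolding apply_gates_parallel [OF inversions_disjoint [OF i]]
    unfolding inversions_def split by (simp add: pre_def post_def del: upt_Suc)
  also have "apply_gates (concat (V i j)) (apply_gates pre \<psi>) =
      apply_gates pre (apply_gates (concat (V i j)) \<psi>)"
  proof (rule apply_gates_commute)
    fix g h assume g: "g \<in> set (concat (V i j))" and h: "h \<in> set pre"
    have "gate_qubits g \<subseteq> nbhd E (S i j) d"
      using gate_qubits_subset_circuit_qubits [OF g] inversion [OF i j(1)] by blast
    with disj [of h] h show "gate_qubits g \<inter> gate_qubits h = {}" by auto
  qed
  finally have eq: "apply_gates (concat (parallel (inversions i))) \<psi> =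
      apply_gates (pre @ post) (apply_gates (concat (V i j)) \<psi>)" by simp
  show ?thesis
    unfolding eq
  proof (rule zero_on_apply_gates)
    show "zero_on q (apply_gates (concat (V i j)) \<psi>)"
      using inversion [OF i j(1)] qj by (blast intro: zero_on_local_inversion [of "{1..n}" "S i j"])
    show "q \<notin> gate_qubits g" if "g \<in> set (pre @ post)" for g
      using disj [OF that] qj subset_nbhd [of "S i j" E d] by blast
  qed
qed

lemma stage_trivial:
  assumes i: "i \<in> {1..l}"
  shows "resets_trivial (concat (reconstruction_stage m S V i)) \<psi>"
    and "fold skip_reset (concat (reconstruction_stage m S V i)) \<psi> = \<psi>"
proof -
  show "resets_trivial (concat (reconstruction_stage m S V i)) \<psi>"
    using zero_on_inverted [OF i] by (simp add: stage_eq concat_map_map resets_trivial_append)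
  have layer: "is_layer E L" if "C \<in> set (inversions i)" "L \<in> set C" for C L
    using that inversion [OF i]
    by (auto simp: inversions_def is_circuit_def atLeastLessThanSuc_atLeastAtMost simp del: upt_Suc)
  have "apply_gates (concat (parallel (map dagger_circuit (inversions i))))
      (apply_gates (concat (parallel (inversions i))) \<psi>) = \<psi>"
    unfolding apply_gates_parallel [OF inversions_disjoint [OF i]]
      apply_gates_parallel [OF dagger_inversions_disjoint [OF i]]
    using apply_gates_dagger_circuits [OF layer inversions_disjoint [OF i]] by (simp add: o_def)
  then show "fold skip_reset (concat (reconstruction_stage m S V i)) \<psi> = \<psi>"
    by (simp add: stage_eq concat_map_map)
qed

abbreviation W :: "nat process" where
  "W \<equiv> reconstruction_process l m S V"

text \<open>Each stage hands \<open>\<psi>\<close> unchanged to the next one, so inversions for the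
  single state \<open>\<psi>\<close> serve all stages.\<close>

lemma process_trivial: "resets_trivial (concat W) \<psi>" "fold skip_reset (concat W) \<psi> = \<psi>"
proof -
  have "resets_trivial (concat (concat (map (reconstruction_stage m S V) is))) \<psi> \<and>
      fold skip_reset (concat (concat (map (reconstruction_stage m S V) is))) \<psi> = \<psi>"
    if "set is \<subseteq> {1..l}" for "is"
    using that by (induction "is") (auto simp: resets_trivial_append stage_trivial)
  from this [of "[1..<Suc l]"]
  show "resets_trivial (concat W) \<psi>" "fold skip_reset (concat W) \<psi> = \<psi>"
    by (simp_all add: reconstruction_process_def atLeastLessThanSuc_atLeastAtMost del: upt_Suc)
qed

lemma stage_layers:
  assumes "i \<in> {1..l}" "L \<in> set (reconstruction_stage m S V i)"
  shows "(\<exists>gs. L = map Unitary gs \<and> is_layer E gs) \<or> (\<exists>qs. L = map Reset qs)"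
proof -
  consider (unitary) L' where "L = map Unitary L'" "L' \<in> set (parallel (inversions i)) \<union>
      set (parallel (map dagger_circuit (inversions i)))" | (reset) "L = map Reset (resets i)"
    using assms(2) by (auto simp: stage_eq)
  then show ?thesis
  proof cases
    case unitary
    then have "is_layer E L'"
      using is_circuit_inversions [OF assms(1)] unfolding is_circuit_def by blast
    with unitary(1) show ?thesis by blast
  qed blast
qed

lemma unitary_depth_stage:
  assumes "i \<in> {1..l}"
  shows "unitary_depth (reconstruction_stage m S V i) \<le> 2 * d"
proof -
  have "unitary_depth (map (map Unitary) C) \<le> d" if "is_circuit E d C" for C
    using unitary_depth_le_length [of "map (map Unitary) C"] that by (simp add: is_circuit_def)
  from this [OF is_circuit_inversions(1) [OF assms]] this [OF is_circuit_inversions(2) [OF assms]]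
  show ?thesis by (simp add: stage_eq unitary_depth_append) (simp add: unitary_depth_def)
qed

text \<open>Above the reset layer of stage \<open>i\<close> there are at most \<open>d\<close>
  layers of daggered inversions and \<open>2 * d\<close> unitary layers for each of the
  \<open>l - i\<close> later stages. The worst case \<open>i = 1\<close> gives
  \<open>(2 * l - 1) * d\<close>, exactly the radius that the covering scheme provides.\<close>

lemma process_covered:
  assumes "v \<in> {1..n}"
  shows "\<exists>r<length W. unitary_depth (drop (Suc r) W) \<le> (2 * l - 1) * d \<and>
    (\<forall>u\<in>nbhd E {v} ((2 * l - 1) * d). Reset u \<in> set (W ! r))"
proof -
  obtain i j where i: "i \<in> {1..l}" and j: "j \<in> {1..m i}"
    and sub: "nbhd E {v} ((2 * l - 1) * d) \<subseteq> S i j"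
    using scheme assms unfolding covering_scheme_def by blast
  let ?st = "reconstruction_stage m S V"
  let ?B = "map (map Unitary) (parallel (map dagger_circuit (inversions i)))"
  define pre where "pre = concat (map ?st [1..<i]) @ map (map Unitary) (parallel (inversions i))"
  define post where "post = ?B @ concat (map ?st [Suc i..<Suc l])"
  have "[1..<Suc l] = [1..<i] @ [i..<Suc l]"
    using i upt_add_eq_append [of 1 i "Suc l - i"] by simp
  also have "[i..<Suc l] = i # [Suc i..<Suc l]"
    using i by (intro upt_conv_Cons) simp
  finally have W: "W = pre @ map Reset (resets i) # post"
    by (simp add: reconstruction_process_def stage_eq [of i] pre_def post_def del: upt_Suc)
  have "unitary_depth (concat (map ?st [Suc i..<Suc l])) \<le> length (map ?st [Suc i..<Suc l]) * (2 * d)"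
    unfolding unitary_depth_def
    by (rule length_filter_concat_le)
      (use unitary_depth_stage i in \<open>auto simp: unitary_depth_def simp del: upt_Suc\<close>)
  moreover have "unitary_depth ?B \<le> d"
    using unitary_depth_le_length [of ?B] is_circuit_inversions(2) [OF i] by (simp add: is_circuit_def)
  ultimately have "unitary_depth post \<le> d + (l - i) * (2 * d)"
    by (simp add: post_def unitary_depth_append del: upt_Suc)
  also have "\<dots> = (2 * (l - i) + 1) * d" by (simp add: algebra_simps)
  also have "\<dots> \<le> (2 * l - 1) * d" using i by (intro mult_right_mono) auto
  finally have "unitary_depth (drop (Suc (length pre)) W) \<le> (2 * l - 1) * d" by (simp add: W)
  moreover have "Reset u \<in> set (W ! length pre)" if "u \<in> nbhd E {v} ((2 * l - 1) * d)" for u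
    using reset_if_covered [OF i j] sub that by (auto simp: W)
  moreover have "length pre < length W" by (simp add: W)
  ultimately show ?thesis by blast
qed

lemma card_reset_layers: "card {r. r < length W \<and> (\<exists>v. Reset v \<in> set (W ! r))} \<le> l"
proof -
  have no_reset: "filter (\<lambda>L. \<exists>v. Reset v \<in> set L) (map (map Unitary) C) = []" for C :: "nat circuit"
    by (auto simp: filter_empty_conv)
  have "length (filter (\<lambda>L. \<exists>v. Reset v \<in> set L) (concat (map (reconstruction_stage m S V) [1..<Suc l])))
      \<le> length (map (reconstruction_stage m S V) [1..<Suc l]) * 1"
    by (rule length_filter_concat_le) (auto simp: stage_eq no_reset simp del: upt_Suc)
  then show ?thesis
    by (simp add: length_filter_conv_card reconstruction_process_def del: upt_Suc)
qed

sublocale resetting_process W E "{1..n}" "(2 * l - 1) * d"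
proof
  fix L assume "L \<in> set W"
  then obtain i where "i \<in> {1..l}" "L \<in> set (reconstruction_stage m S V i)"
    by (auto simp: reconstruction_process_def atLeastLessThanSuc_atLeastAtMost simp del: upt_Suc)
  then show "(\<exists>gs. L = map Unitary gs \<and> is_layer E gs) \<or> (\<exists>qs. L = map Reset qs)"
    by (rule stage_layers)
qed (use edges process_covered in auto)

end

lemma is_state_run:
  assumes "is_circuit E d U" "E \<subseteq> Q \<times> Q" "finite Q" "is_state Q \<psi>"
  shows "is_state Q (run U \<psi>)"
  unfolding run_def
proof (rule is_state_apply_gates [OF assms(4)])
  fix g assume "g \<in> set (concat U)"
  then obtain L where "is_layer E L" "g \<in> set L" using assms(1) by (auto simp: is_circuit_def)
  with assms(2) show "gate_qubits g \<subseteq> Q" "proper_gate g"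
    by (cases g; auto simp: is_layer_def proper_gate_def)+
qed

theorem theorem2:
  fixes l :: nat
  shows "\<exists>K::nat. \<forall>(k::nat) (n::nat) (d::nat) (c::nat) (E::(nat \<times> nat) set)
      (U::nat circuit) (\<psi>::nat qvec) (m::nat \<Rightarrow> nat)
      (S::nat \<Rightarrow> nat \<Rightarrow> nat set) (V::nat \<Rightarrow> nat \<Rightarrow> nat circuit).
    is_lattice k n E \<longrightarrow>
    is_circuit E d U \<longrightarrow>
    \<psi> = run U zero_state \<longrightarrow>
    covering_scheme n E l c d m S \<longrightarrow>
    (\<forall>i\<in>{1..l}. \<forall>j\<in>{1..m i}.
       is_circuit E d (V i j) \<and> circuit_qubits (V i j) \<subseteq> nbhd E (S i j) d \<and>
       local_inversion {1..n} (S i j) (V i j) \<psi>) \<longrightarrow>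
    (let W = reconstruction_process l m S V;
         C = lightcone W {1..n};
         sys = output_line W ` {1..n};
         anc = ancillas W {1..n}
     in run_process W (pure \<psi>) = pure \<psi> \<and>
        \<not> reaches_input W {1..n} \<and>
        (\<forall>(v, s)\<in>sys \<union> anc. s \<noteq> None) \<and>
        is_circuit (line_edges E) ((2 * l - 1) * d) C \<and>
        circuit_qubits C \<subseteq> sys \<union> anc \<and>
        card anc \<le> K * n \<and>
        (\<exists>junk. is_state anc junk \<and>
           run C (tensor sys anc zero_state zero_state) =
             tensor sys anc (relabel (output_line W) {1..n} \<psi>) junk))"
proof (intro exI [of _ l] allI impI)
  fix k n d c :: nat and E :: "(nat \<times> nat) set" and U :: "nat circuit" and \<psi> :: "nat qvec"
    and m :: "nat \<Rightarrow> nat" and S :: "nat \<Rightarrow> nat \<Rightarrow> nat set" and V :: "nat \<Rightarrow> nat \<Rightarrow> nat circuit"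
  assume lattice: "is_lattice k n E" and U: "is_circuit E d U" "\<psi> = run U zero_state"
    and scheme: "covering_scheme n E l c d m S"
    and inv: "\<forall>i\<in>{1..l}. \<forall>j\<in>{1..m i}. is_circuit E d (V i j) \<and>
      circuit_qubits (V i j) \<subseteq> nbhd E (S i j) d \<and> local_inversion {1..n} (S i j) (V i j) \<psi>"
  interpret reconstruction n E l c d m S V \<psi>
    by unfold_locales (use lattice_edges [OF lattice] scheme inv in auto)
  have state: "is_state {1..n} \<psi>"
    unfolding U(2) by (intro is_state_run [OF U(1) edges(1)] is_state_zero_state) auto
  have "run_process W (pure \<psi>) = pure \<psi>"
    using fold_apply_operation_pure [OF process_trivial(1)] process_trivial(2)
    by (simp add: run_process_def)
  moreover have "\<forall>(v, s)\<in>output_line W ` {1..n} \<union> ancillas W {1..n}. s \<noteq> None"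
    using lines_not_input by (metis (mono_tags, lifting) case_prodI2 snd_conv)
  moreover have "circuit_qubits (lightcone W {1..n}) \<subseteq> output_line W ` {1..n} \<union> ancillas W {1..n}"
    by (auto simp: ancillas_def)
  \<comment> \<open>An ancilla is a line beginning at a reset, determined by its qubit and the reset
    layer. There are at most \<open>l\<close> reset layers, so the constant depends on
    \<open>l\<close> alone.\<close>
  moreover have "card (ancillas W {1..n}) \<le> l * n"
  proof -
    have "card (ancillas W {1..n}) \<le> n * card {r. r < length W \<and> (\<exists>v. Reset v \<in> set (W ! r))}"
      using card_ancillas by simp
    also have "\<dots> \<le> n * l" by (rule mult_le_mono2 [OF card_reset_layers])
    finally show ?thesis by (simp only: mult.commute)
  qed
  ultimately show "let W = reconstruction_process l m S V;
         C = lightcone W {1..n};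
         sys = output_line W ` {1..n};
         anc = ancillas W {1..n}
     in run_process W (pure \<psi>) = pure \<psi> \<and>
        \<not> reaches_input W {1..n} \<and>
        (\<forall>(v, s)\<in>sys \<union> anc. s \<noteq> None) \<and>
        is_circuit (line_edges E) ((2 * l - 1) * d) C \<and>
        circuit_qubits C \<subseteq> sys \<union> anc \<and>
        card anc \<le> l * n \<and>
        (\<exists>junk. is_state anc junk \<and>
           run C (tensor sys anc zero_state zero_state) =
             tensor sys anc (relabel (output_line W) {1..n} \<psi>) junk)"
    unfolding Let_def
    using not_reaches_input is_circuit_lightcone lightcone_prepares [OF state process_trivial]
    by (intro conjI)
qed

end
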